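(* Let $N, K, m$ be positive integers, let $V : \mathbb{C}^K \to \mathbb{C}^N$ be an isometry (the encoding isometry), and let $\{E_1, \ldots, E_m\}$ be a unitary error set on $\mathbb{C}^N$. Let $0 \leq \delta < 1$. If $V$ is a $\delta$-approximate nondegenerate code with respect to $\{E_1, \ldots, E_m\}$, then $V$ specifies an approximate quantum error-correcting code which corrects for the set of errors $\mathcal{E} = \mathrm{span}\{E_1, \ldots, E_m\}$ with disturbance $\delta$.
   Context: Unitary error set: a set $\{E_1,\ldots,E_m\}$ of $N\times N$ unitary matrices with $\mathrm{tr}(E_i^\dagger E_j)=0$ for all $i \neq j$. Spans are complex linear spans. Approximate isometry: for $\delta\ge 0$, a complex $N\times \ell$ matrix $T$ with $N \geq \ell$ is a $\delta$-approximate isometry if $1-\delta \leq s_{\min}(T) \leq s_{\max}(T) \leq 1+\delta$, where $s_{\min}(T), s_{\max}(T)$ are the smallest and largest of the $\ell$ singular values of $T$; equivalently $1-\delta \le \|T|c\rangle\| \le 1+\delta$ for every unit vector $|c\rangle\in\mathbb{C}^\ell$. Approximate nondegenerate code: an isometry $V:\mathbb{C}^K\to\mathbb{C}^N$ is a $\delta$-approximate nondegenerate code with respect to a unitary error set $\{E_1,\ldots,E_m\}$ if the $N \times Km$ matrix $\sum_{i=1}^m E_i V \otimes \langle i|$ (a map $\mathbb{C}^K\otimes\mathbb{C}^m\to\mathbb{C}^N$ sending $|j\rangle\otimes|i\rangle \mapsto E_iV|j\rangle$) is a $\delta$-approximate isometry (in particular $Km\le N$). Noise channels: for a set $\mathcal{E}$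 of linear operators on $\mathbb{C}^N$, $\mathsf{Channels}(\mathcal{E})$ is the set of quantum channels $\mathcal{N}$ on $\mathbb{C}^N$ having a Kraus decomposition $\mathcal{N}(\rho)=\sum_i K_i\rho K_i^\dagger$ with every $K_i\in\mathcal{E}$. Correction with disturbance: the code specified by an isometry $V:\mathbb{C}^K\to\mathbb{C}^N$ has encoding channel $\mathsf{Enc}(\rho)=V\rho V^\dagger$. It corrects for a set of errors $\mathcal{E}$ with disturbance $\epsilon$ if there exists a quantum channel $\mathsf{Dec}$ from operators on $\mathbb{C}^N$ to operators on $\mathbb{C}^K$ such that for every $\mathcal{N}\in\mathsf{Channels}(\mathcal{E})$, $\frac12\|\mathsf{Dec}\circ\mathcal{N}\circ\mathsf{Enc}-\mathcal{I}\|_\diamond\leq\epsilon$, where $\mathcal{I}$ is the identity channel on $\mathbb{C}^K$ and $\|\cdot\|_\diamond$ is the diamond norm. *)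

theory Defs
  imports "Jordan_Normal_Form.Schur_Decomposition"
begin

text \<open>
  Operators from $\mathbf{C}^n$ to $\mathbf{C}^k$ are matrices in \<^term>\<open>carrier_mat k n :: complex mat set\<close>, with
  basis vectors numbered from 0, and \<^const>\<open>mat_adjoint\<close> is the conjugate transpose. The basis
  vector $|i\rangle \otimes |a\rangle$ of $\mathbf{C}^n \otimes \mathbf{C}^r$ has number \<open>i * r + a\<close>.
\<close>

subsection \<open>Matrices\<close>

text \<open>The type of matrices has no zero, so sums of matrices need explicit dimensions.\<close>

definition msum :: "nat \<Rightarrow> nat \<Rightarrow> 'i set \<Rightarrow> ('i \<Rightarrow> complex mat) \<Rightarrow> complex mat" where
  "msum nr nc I F = mat nr nc (\<lambda>(r, s). \<Sum>i\<in>I. F i $$ (r, s))"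

definition mtrace :: "complex mat \<Rightarrow> complex" where
  "mtrace A = (\<Sum>i<dim_row A. A $$ (i, i))"

definition kron :: "complex mat \<Rightarrow> complex mat \<Rightarrow> complex mat" where
  "kron A B = mat (dim_row A * dim_row B) (dim_col A * dim_col B)
     (\<lambda>(i, j). A $$ (i div dim_row B, j div dim_col B) * B $$ (i mod dim_row B, j mod dim_col B))"

definition bra :: "nat \<Rightarrow> nat \<Rightarrow> complex mat" where
  "bra m i = mat 1 m (\<lambda>(_, j). if j = i then 1 else 0)"

definition isometry :: "nat \<Rightarrow> nat \<Rightarrow> complex mat \<Rightarrow> bool" where
  "isometry k n V \<longleftrightarrow> V \<in> carrier_mat n k \<and> mat_adjoint V * V = 1\<^sub>m k"

definition unitary :: "nat \<Rightarrow> complex mat \<Rightarrow> bool" where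
  "unitary n U \<longleftrightarrow> U \<in> carrier_mat n n \<and> mat_adjoint U * U = 1\<^sub>m n \<and> U * mat_adjoint U = 1\<^sub>m n"

text \<open>Over the complex numbers a nonnegative quadratic form makes the matrix Hermitian; the
  relation \<open>0 \<le> z\<close> on complex numbers says that \<open>z\<close> is real and nonnegative.\<close>

definition psd :: "nat \<Rightarrow> complex mat \<Rightarrow> bool" where
  "psd n A \<longleftrightarrow> A \<in> carrier_mat n n \<and> (\<forall>v\<in>carrier_vec n. 0 \<le> (A *\<^sub>v v) \<bullet>c v)"

text \<open>The singular values of \<open>T\<close>, as many as \<open>T\<close> has columns: the square roots of the eigenvalues of
  \<open>mat_adjoint T * T\<close>, which are real and nonnegative, with multiplicity.\<close>

definition singular_values :: "complex mat \<Rightarrow> real multiset" where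
  "singular_values T =
     image_mset (\<lambda>z. sqrt (Re z)) (proots (char_poly (mat_adjoint T * T)))"

definition s_min :: "complex mat \<Rightarrow> real" where
  "s_min T = Min (set_mset (singular_values T))"

definition s_max :: "complex mat \<Rightarrow> real" where
  "s_max T = Max (set_mset (singular_values T))"

definition trace_norm :: "complex mat \<Rightarrow> real" where
  "trace_norm X = sum_mset (singular_values X)"

subsection \<open>Superoperators and channels\<close>

text \<open>A superoperator is a function on matrices of which only the values on
  \<^term>\<open>carrier_mat d d :: complex mat set\<close> matter, \<open>d\<close> being the input dimension.\<close>

definition linear_superop ::
  "nat \<Rightarrow> nat \<Rightarrow> (complex mat \<Rightarrow> complex mat) \<Rightarrow> bool" where
  "linear_superop d e \<Phi> \<longleftrightarrow>
     (\<forall>X\<in>carrier_mat d d. \<Phi> X \<in> carrier_mat e e) \<and>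
     (\<forall>X\<in>carrier_mat d d. \<forall>Y\<in>carrier_mat d d. \<Phi> (X + Y) = \<Phi> X + \<Phi> Y) \<and>
     (\<forall>X\<in>carrier_mat d d. \<forall>c. \<Phi> (c \<cdot>\<^sub>m X) = c \<cdot>\<^sub>m \<Phi> X)"

text \<open>The superoperator $\Phi \otimes \mathrm{id}_r$: it applies \<open>\<Phi>\<close> to the slice
  $(I \otimes \langle a|) X (I \otimes |b\rangle)$ for each pair of basis vectors \<open>a\<close>, \<open>b\<close> of
  $\mathbf{C}^r$.\<close>

definition tensor_id ::
  "nat \<Rightarrow> nat \<Rightarrow> nat \<Rightarrow> (complex mat \<Rightarrow> complex mat) \<Rightarrow> complex mat \<Rightarrow> complex mat" where
  "tensor_id r d e \<Phi> X = mat (e * r) (e * r) (\<lambda>(i, j).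
     \<Phi> (mat d d (\<lambda>(k, l). X $$ (k * r + i mod r, l * r + j mod r))) $$ (i div r, j div r))"

lemma tensor_id_kron:
  assumes \<Phi>: "linear_superop d e \<Phi>" and A: "A \<in> carrier_mat d d" and B: "B \<in> carrier_mat r r"
  shows "tensor_id r d e \<Phi> (kron A B) = kron (\<Phi> A) B"
proof -
  have \<Phi>A: "\<Phi> A \<in> carrier_mat e e"
    using \<Phi> A by (auto simp: linear_superop_def)
  have bound: "k * r + a < d * r" if "k < d" "a < r" for k a
  proof -
    have "k * r + a < Suc k * r" using that by simp
    also have "\<dots> \<le> d * r" using that by (intro mult_le_mono1) simp
    finally show ?thesis .
  qed
  have slice: "mat d d (\<lambda>(k, l). kron A B $$ (k * r + a, l * r + b)) = B $$ (a, b) \<cdot>\<^sub>m A"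
    if "a < r" "b < r" for a b
    using A B that by (intro eq_matI) (auto simp: kron_def bound)
  show ?thesis
  proof (rule eq_matI)
    fix i j assume "i < dim_row (kron (\<Phi> A) B)" "j < dim_col (kron (\<Phi> A) B)"
    then have ij: "i < e * r" "j < e * r" using \<Phi>A B by (auto simp: kron_def)
    then have r: "0 < r" by (cases r) auto
    have m: "i mod r < r" "j mod r < r" using r by auto
    have q: "i div r < e" "j div r < e" using ij by (auto simp: less_mult_imp_div_less)
    have "\<Phi> (B $$ (i mod r, j mod r) \<cdot>\<^sub>m A) = B $$ (i mod r, j mod r) \<cdot>\<^sub>m \<Phi> A"
      using \<Phi> A by (auto simp: linear_superop_def)
    then have "tensor_id r d e \<Phi> (kron A B) $$ (i, j) =
        (B $$ (i mod r, j mod r) \<cdot>\<^sub>m \<Phi> A) $$ (i div r, j div r)"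
      using ij by (simp add: tensor_id_def slice[OF m])
    then show "tensor_id r d e \<Phi> (kron A B) $$ (i, j) = kron (\<Phi> A) B $$ (i, j)"
      using ij q \<Phi>A B by (simp add: kron_def)
  qed (use \<Phi>A B in \<open>auto simp: tensor_id_def kron_def\<close>)
qed

definition quantum_channel ::
  "nat \<Rightarrow> nat \<Rightarrow> (complex mat \<Rightarrow> complex mat) \<Rightarrow> bool" where
  "quantum_channel d e \<Phi> \<longleftrightarrow>
     linear_superop d e \<Phi> \<and>
     (\<forall>X\<in>carrier_mat d d. mtrace (\<Phi> X) = mtrace X) \<and>
     (\<forall>r X. psd (d * r) X \<longrightarrow> psd (e * r) (tensor_id r d e \<Phi> X))"

definition Channels :: "nat \<Rightarrow> complex mat set \<Rightarrow> (complex mat \<Rightarrow> complex mat) set" where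
  "Channels n S = {\<N>. quantum_channel n n \<N> \<and>
     (\<exists>Ks. set Ks \<subseteq> S \<and>
        (\<forall>\<rho>\<in>carrier_mat n n.
           \<N> \<rho> = msum n n {..<length Ks} (\<lambda>i. Ks ! i * \<rho> * mat_adjoint (Ks ! i))))}"

text \<open>For a linear superoperator the set below is bounded, with its supremum attained already at
  \<open>r = d\<close> if \<open>d > 0\<close>.\<close>

definition diamond_norm ::
  "nat \<Rightarrow> nat \<Rightarrow> (complex mat \<Rightarrow> complex mat) \<Rightarrow> real" where
  "diamond_norm d e \<Phi> = Sup {trace_norm (tensor_id r d e \<Phi> X) | r X.
     1 \<le> r \<and> X \<in> carrier_mat (d * r) (d * r) \<and> trace_norm X \<le> 1}"

subsection \<open>Codes\<close>

text \<open>A family of errors $E_1, \dots, E_m$ is represented by \<open>E 0, \<dots>, E (m - 1)\<close>.\<close>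

definition unitary_error_set :: "nat \<Rightarrow> nat \<Rightarrow> (nat \<Rightarrow> complex mat) \<Rightarrow> bool" where
  "unitary_error_set n m E \<longleftrightarrow>
     (\<forall>i<m. unitary n (E i)) \<and>
     (\<forall>i<m. \<forall>j<m. i \<noteq> j \<longrightarrow> mtrace (mat_adjoint (E i) * E j) = 0)"

definition error_span :: "nat \<Rightarrow> nat \<Rightarrow> (nat \<Rightarrow> complex mat) \<Rightarrow> complex mat set" where
  "error_span n m E = {msum n n {..<m} (\<lambda>i. c i \<cdot>\<^sub>m E i) | c :: nat \<Rightarrow> complex. True}"

definition approx_isometry :: "real \<Rightarrow> nat \<Rightarrow> nat \<Rightarrow> complex mat \<Rightarrow> bool" where
  "approx_isometry \<delta> n l T \<longleftrightarrow>
     T \<in> carrier_mat n l \<and> l \<le> n \<and>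
     1 - \<delta> \<le> s_min T \<and> s_min T \<le> s_max T \<and> s_max T \<le> 1 + \<delta>"

definition approx_nondegenerate_code ::
  "real \<Rightarrow> nat \<Rightarrow> nat \<Rightarrow> nat \<Rightarrow> (nat \<Rightarrow> complex mat) \<Rightarrow> complex mat \<Rightarrow> bool" where
  "approx_nondegenerate_code \<delta> n k m E V \<longleftrightarrow>
     approx_isometry \<delta> n (k * m)
       (msum n (k * m) {..<m} (\<lambda>i. kron (E i * V) (bra m i)))"

definition Enc :: "complex mat \<Rightarrow> complex mat \<Rightarrow> complex mat" where
  "Enc V \<rho> = V * \<rho> * mat_adjoint V"

definition corrects_with_disturbance ::
  "nat \<Rightarrow> nat \<Rightarrow> complex mat \<Rightarrow> complex mat set \<Rightarrow> real \<Rightarrow> bool" where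
  "corrects_with_disturbance n k V S \<epsilon> \<longleftrightarrow>
     (\<exists>Dec. quantum_channel n k Dec \<and>
        (\<forall>\<N>\<in>Channels n S.
           1 / 2 * diamond_norm k k (\<lambda>\<rho>. Dec (\<N> (Enc V \<rho>)) - \<rho>) \<le> \<epsilon>))"

end

theory Submission
  imports Defs "Jordan_Normal_Form.Spectral_Radius" "HOL-Analysis.L2_Norm"
begin

text \<open>
  Let $T$ be the matrix of the code and $W$ the isometry in its polar decomposition, so that
  $\|T - W\| \le \delta$. The decoder inverts $W$ and traces out $\mathbf{C}^m$. For a channel with
  Kraus operators $K_a = \sum_i c_{ai} E_i$, trace preservation and the orthogonality of the errors
  give $\sum_{a,i} |c_{ai}|^2 = 1$. Since $K_a V x = T (x \otimes c_a)$, the Kraus operators of the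
  decoded channel differ from those obtained with $W$ in place of $T$, which represent the identity
  channel, by a family of norm at most $\delta$. Both families have norm 1, so the diamond distance
  is at most $2 \delta$. Estimating the stacked Kraus operators, rather than $T \rho T^*$ and
  $W \rho W^*$, avoids a loss of order $\delta^2$, because the former are exact isometries.
\<close>

subsection \<open>Diagonalization of Hermitian matrices\<close>

text \<open>The decoder has to be chosen before the noise. One \<open>W\<close> can serve every
  channel because the noise meets the code only through the product vectors x \<otimes> c_a, on
  which operator b of the partial trace returns c_ab x after \<open>W\<close> is undone. The
  comparison family thus consists of scalar multiples of the identity, and the total weight 1 makes
  the map that it represents exactly the identity. The diamond norm ranges over all matrices of
  trace norm at most 1 on all ancillas, not just over states. A singular value decomposition of the
  input reduces this to rank one terms with different left and right vectors, and squared norms add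
  over the ancilla slices, so that an inequality for vectors of C^K settles every ancilla at once.
  The assumption \<delta> < 1 keeps the singular values of T positive, so that the polar factor is a
  genuine isometry. The quadratic loss mentioned above would come from the norm of T, which may
  reach 1 + \<delta> and would enter one of the two terms of the split difference.\<close>

lemma adjoint_carrier [simp]: "mat_adjoint A \<in> carrier_mat m n" if "A \<in> carrier_mat n m"
  using that by (auto simp: mat_adjoint_def mat_of_rows_def)

lemma adjoint_dim [simp]:
  "dim_row (mat_adjoint A) = dim_col A" "dim_col (mat_adjoint A) = dim_row A"
  by (auto simp: mat_adjoint_def mat_of_rows_def)

lemma adjoint_index [simp]:
  "i < dim_col A \<Longrightarrow> j < dim_row A \<Longrightarrow> mat_adjoint A $$ (i, j) = cnj (A $$ (j, i))"
  by (simp add: mat_adjoint_def mat_of_rows_def)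

lemma adjoint_adjoint [simp]: "mat_adjoint (mat_adjoint A) = (A :: complex mat)"
  by (rule eq_matI) auto

lemma mult_mat_index:
  "A \<in> carrier_mat n k \<Longrightarrow> B \<in> carrier_mat k l \<Longrightarrow> i < n \<Longrightarrow> j < l \<Longrightarrow>
    (A * B) $$ (i, j) = (\<Sum>p<k. A $$ (i, p) * B $$ (p, j))"
  by (auto simp: scalar_prod_def atLeast0LessThan)

lemma adjoint_mult:
  fixes A B :: "complex mat"
  assumes "A \<in> carrier_mat n k" "B \<in> carrier_mat k l"
  shows "mat_adjoint (A * B) = mat_adjoint B * mat_adjoint A"
proof (rule eq_matI)
  fix i j assume "i < dim_row (mat_adjoint B * mat_adjoint A)" "j < dim_col (mat_adjoint B * mat_adjoint A)"
  then have ij: "i < l" "j < n" using assms by auto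
  have "mat_adjoint (A * B) $$ (i, j) = cnj ((A * B) $$ (j, i))"
    using assms ij by (intro adjoint_index) auto
  then show "mat_adjoint (A * B) $$ (i, j) = (mat_adjoint B * mat_adjoint A) $$ (i, j)"
    using assms ij by (simp add: mult_mat_index[of _ n k _ l] mult_mat_index[of _ l k _ n] mult.commute
        del: index_mult_mat)
qed (use assms in auto)

lemma adjoint_mult_index:
  assumes "A \<in> carrier_mat n k" "B \<in> carrier_mat n l" "i < k" "j < l"
  shows "(mat_adjoint A * B) $$ (i, j) = (\<Sum>p<n. cnj (A $$ (p, i)) * B $$ (p, j))"
  using assms by (subst mult_mat_index[of _ k n]) auto

text \<open>Instantiated at a single dimension, these facts serve as rewrite rules: products are
  reassociated to the right, and the first two facts discharge the carrier conditions that
  arise.\<close>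

lemma square_mat_mult:
  fixes A B C :: "complex mat"
  shows "A \<in> carrier_mat n n \<Longrightarrow> B \<in> carrier_mat n n \<Longrightarrow> A * B \<in> carrier_mat n n"
    and "A \<in> carrier_mat n n \<Longrightarrow> mat_adjoint A \<in> carrier_mat n n"
    and "A \<in> carrier_mat n n \<Longrightarrow> B \<in> carrier_mat n n \<Longrightarrow> C \<in> carrier_mat n n \<Longrightarrow>
      A * B * C = A * (B * C)"
    and "A \<in> carrier_mat n n \<Longrightarrow> B \<in> carrier_mat n n \<Longrightarrow>
      mat_adjoint (A * B) = mat_adjoint B * mat_adjoint A"
  using adjoint_mult[of A n n B n] by auto

lemma unitary_mult: "unitary n U \<Longrightarrow> unitary n W \<Longrightarrow> unitary n (U * W)"
  unfolding unitary_def
proof (intro conjI; elim conjE)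
  assume U: "U \<in> carrier_mat n n" "mat_adjoint U * U = 1\<^sub>m n" "U * mat_adjoint U = 1\<^sub>m n"
    and W: "W \<in> carrier_mat n n" "mat_adjoint W * W = 1\<^sub>m n" "W * mat_adjoint W = 1\<^sub>m n"
  show "U * W \<in> carrier_mat n n" using U W by simp
  have "mat_adjoint (U * W) * (U * W) = mat_adjoint W * (mat_adjoint U * U) * W"
    using U(1) W(1) by (simp add: square_mat_mult[of _ n])
  then show "mat_adjoint (U * W) * (U * W) = 1\<^sub>m n" using U W by simp
  have "U * W * mat_adjoint (U * W) = U * (W * mat_adjoint W) * mat_adjoint U"
    using U(1) W(1) by (simp add: square_mat_mult[of _ n])
  then show "U * W * mat_adjoint (U * W) = 1\<^sub>m n" using U W by simp
qed

lemma unitaryI: "U \<in> carrier_mat n n \<Longrightarrow> mat_adjoint U * U = 1\<^sub>m n \<Longrightarrow> unitary n U"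
  unfolding unitary_def using mat_mult_left_right_inverse[of "mat_adjoint U" n U] by auto

lemma cscalar_prod_self:
  fixes v :: "complex vec"
  shows "v \<bullet>c v = of_real (\<Sum>k<dim_vec v. (cmod (v $ k))\<^sup>2)"
  by (simp add: scalar_prod_def complex_norm_square atLeast0LessThan
      del: of_real_power)

text \<open>Gram-Schmidt keeps the head of its list, so a basis that starts with \<open>v\<close>
  can be orthogonalized and normalized without changing the direction of its first vector.\<close>

lemma ex_unitary_first_col:
  fixes v :: "complex vec"
  assumes v: "v \<in> carrier_vec n" "v \<noteq> 0\<^sub>v n" and n: "0 < n"
  shows "\<exists>U c. unitary n U \<and> col U 0 = c \<cdot>\<^sub>v v"
proof -
  interpret cof_vec_space n "TYPE(complex)" .
  define b where "b = basis_completion v"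
  define ws where "ws = gram_schmidt n b"
  note bc = basis_completion[OF v, folded b_def]
  from bc(6,7) n obtain vs where bv: "b = v # vs" by (cases b) auto
  from gram_schmidt_result[OF bc(2,4,5) refl, folded ws_def]
  have ws: "set ws \<subseteq> carrier_vec n" "corthogonal ws" "length ws = n"
    using bc(6) by auto
  have hd: "hd ws = v" using gram_schmidt_hd[OF v(1), of vs, folded bv] by (simp add: ws_def)
  have ws0: "ws ! 0 = v" using hd ws(3) n by (cases ws) auto
  have wc: "ws ! j \<in> carrier_vec n" if "j < n" for j using ws that by auto
  define l where "l j = sqrt (\<Sum>k<n. (cmod (ws ! j $ k))\<^sup>2)" for j
  have sq: "ws ! j \<bullet>c ws ! j = complex_of_real ((l j)\<^sup>2)" if "j < n" for j
    using wc[OF that] by (simp add: l_def cscalar_prod_self sum_nonneg)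
  \<comment> \<open>\<open>corthogonal\<close> includes that no member is orthogonal to itself, so
    the lengths do not vanish.\<close>
  have l0: "l j \<noteq> 0" if "j < n" for j
    using corthogonalD[OF ws(2), of j j] ws(3) that sq[OF that] by auto
  define U where "U = mat n n (\<lambda>(i, j). ws ! j $ i / complex_of_real (l j))"
  have U: "U \<in> carrier_mat n n" by (simp add: U_def)
  have "mat_adjoint U * U = 1\<^sub>m n"
  proof (rule eq_matI)
    fix i j assume "i < dim_row (1\<^sub>m n :: complex mat)" "j < dim_col (1\<^sub>m n :: complex mat)"
    then have ij: "i < n" "j < n" by auto
    have "(mat_adjoint U * U) $$ (i, j) = (\<Sum>p<n. cnj (U $$ (p, i)) * U $$ (p, j))"
      using adjoint_mult_index[OF U U ij] .
    also have "\<dots> = (\<Sum>p<n. ws ! j $ p * cnj (ws ! i $ p)) / complex_of_real (l i * l j)"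
      using ij by (simp add: U_def sum_divide_distrib mult.commute)
    also have "(\<Sum>p<n. ws ! j $ p * cnj (ws ! i $ p)) = ws ! j \<bullet>c ws ! i"
      using wc[OF ij(1)] by (simp add: scalar_prod_def atLeast0LessThan)
    also have "\<dots> / complex_of_real (l i * l j) = 1\<^sub>m n $$ (i, j)"
    proof (cases "i = j")
      case True
      then show ?thesis using sq[OF ij(1)] l0[OF ij(1)] ij by (simp add: power2_eq_square)
    next
      case False
      then show ?thesis using corthogonalD[OF ws(2), of j i] ij ws(3) by simp
    qed
    finally show "(mat_adjoint U * U) $$ (i, j) = 1\<^sub>m n $$ (i, j)" .
  qed (use U in auto)
  then have "unitary n U" using unitaryI[OF U] by simp
  moreover have "col U 0 = (1 / complex_of_real (l 0)) \<cdot>\<^sub>v v"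
    using n v by (intro eq_vecI) (auto simp: U_def ws0)
  ultimately show ?thesis by blast
qed

lemma four_block_adjoint:
  fixes A B C D :: "complex mat"
  assumes "A \<in> carrier_mat nr1 nc1" "B \<in> carrier_mat nr1 nc2"
    "C \<in> carrier_mat nr2 nc1" "D \<in> carrier_mat nr2 nc2"
  shows "mat_adjoint (four_block_mat A B C D) =
    four_block_mat (mat_adjoint A) (mat_adjoint C) (mat_adjoint B) (mat_adjoint D)"
  using assms by (intro eq_matI) auto

lemma adjoint_zero_mat [simp]: "mat_adjoint (0\<^sub>m n k :: complex mat) = 0\<^sub>m k n"
  by (rule eq_matI) auto

lemma adjoint_one_mat [simp]: "mat_adjoint (1\<^sub>m n :: complex mat) = 1\<^sub>m n"
  by (rule eq_matI) auto

text \<open>Deflation: in an orthonormal basis that starts with an eigenvector, the first column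
  vanishes below its top entry, and Hermitian symmetry clears the first row as well. The remaining
  block is Hermitian and smaller.\<close>

theorem hermitian_diagonalization:
  fixes A :: "complex mat"
  assumes "A \<in> carrier_mat n n" "mat_adjoint A = A"
  shows "\<exists>U f. unitary n U \<and> mat_adjoint U * A * U = mat_diag n f"
  using assms
proof (induction n arbitrary: A)
  case 0
  then have "unitary 0 (1\<^sub>m 0)" "mat_adjoint (1\<^sub>m 0) * A * 1\<^sub>m 0 = mat_diag 0 (\<lambda>_. 0)"
    by (auto simp: unitary_def mat_diag_def intro!: eq_matI)
  then show ?case by blast
next
  case (Suc n)
  note A = Suc.prems(1) and herm = Suc.prems(2)
  obtain e where "e \<in> spectrum A" using spectrum_non_empty[OF A] by auto
  then obtain v where v: "v \<in> carrier_vec (Suc n)" "v \<noteq> 0\<^sub>v (Suc n)" "A *\<^sub>v v = e \<cdot>\<^sub>v v"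
    using A by (auto simp: spectrum_def eigenvalue_def eigenvector_def)
  obtain U c where U: "unitary (Suc n) U" and col: "col U 0 = c \<cdot>\<^sub>v v"
    using ex_unitary_first_col[OF v(1,2)] by auto
  have Uc: "U \<in> carrier_mat (Suc n) (Suc n)" and UU: "mat_adjoint U * U = 1\<^sub>m (Suc n)"
    using U by (auto simp: unitary_def)
  define B where "B = mat_adjoint U * A * U"
  have B: "B \<in> carrier_mat (Suc n) (Suc n)" using A Uc by (simp add: B_def square_mat_mult[of _ "Suc n"])
  have Bherm: "mat_adjoint B = B"
    using A Uc herm
    by (simp add: B_def square_mat_mult[of _ "Suc n"])
  have B0: "B $$ (i, 0) = (if i = 0 then e else 0)" if i: "i < Suc n" for i
  proof -
    \<comment> \<open>Column 0 of \<open>U\<close> is a multiple of \<open>v\<close>, hence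
      satisfies the same eigenvalue equation.\<close>
    have "col (A * U) 0 = e \<cdot>\<^sub>v col U 0"
      unfolding col_mult2[OF A Uc zero_less_Suc] col mult_mat_vec[OF A v(1)] v(3)
      by (simp add: smult_smult_assoc mult.commute)
    then have AU: "(A * U) $$ (p, 0) = e * U $$ (p, 0)" if "p < Suc n" for p
      using that A Uc by (metis (no_types, lifting) carrier_matD col_carrier_vec index_col index_mult_mat(2,3)
          index_smult_vec(1) carrier_vecD zero_less_Suc)
    have "B $$ (i, 0) = (mat_adjoint U * (A * U)) $$ (i, 0)"
      using A Uc by (simp add: B_def square_mat_mult[of _ "Suc n"])
    also have "\<dots> = e * (mat_adjoint U * U) $$ (i, 0)"
      using A Uc i by (simp add: adjoint_mult_index[of _ "Suc n" "Suc n" _ "Suc n"] square_mat_mult(1) AU sum_distrib_left mult_ac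
          del: sum.lessThan_Suc index_mult_mat)
    finally show ?thesis using i by (simp add: UU)
  qed
  have B0': "B $$ (0, j) = (if j = 0 then e else 0)" if j: "j < Suc n" for j
  proof -
    have "B $$ (0, j) = cnj (B $$ (j, 0))"
      using B j by (subst Bherm[symmetric], subst adjoint_index) auto
    moreover have "B $$ (0, 0) = cnj (B $$ (0, 0))"
      using B j by (subst (1) Bherm[symmetric], subst adjoint_index) auto
    ultimately show ?thesis using B0[OF j] B0[of 0] by auto
  qed
  define C where "C = mat n n (\<lambda>(i, j). B $$ (Suc i, Suc j))"
  have C: "C \<in> carrier_mat n n" by (simp add: C_def)
  have "mat_adjoint C = C"
  proof (rule eq_matI)
    fix i j assume ij: "i < dim_row C" "j < dim_col C"
    then have "B $$ (Suc i, Suc j) = cnj (B $$ (Suc j, Suc i))"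
      using B C by (subst Bherm[symmetric], subst adjoint_index) auto
    then show "mat_adjoint C $$ (i, j) = C $$ (i, j)" using ij C by (simp add: C_def)
  qed (use C in auto)
  from Suc.IH[OF C this] obtain Q f where Q: "unitary n Q" and Qd: "mat_adjoint Q * C * Q = mat_diag n f"
    by blast
  have Qc: "Q \<in> carrier_mat n n" and QQ: "mat_adjoint Q * Q = 1\<^sub>m n" using Q by (auto simp: unitary_def)
  have Bblock: "B = four_block_mat (mat 1 1 (\<lambda>_. e)) (0\<^sub>m 1 n) (0\<^sub>m n 1) C"
    using B by (intro eq_matI) (auto simp: C_def B0 B0' less_Suc_eq_0_disj)
  define Q' where "Q' = four_block_mat (1\<^sub>m 1) (0\<^sub>m 1 n) (0\<^sub>m n 1) Q"
  have Q': "Q' \<in> carrier_mat (Suc n) (Suc n)" using Qc by (auto simp: Q'_def)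
  have aQ': "mat_adjoint Q' = four_block_mat (1\<^sub>m 1) (0\<^sub>m 1 n) (0\<^sub>m n 1) (mat_adjoint Q)"
    unfolding Q'_def using Qc by (subst four_block_adjoint[of _ 1 1 _ n _ n]) auto
  have "mat_adjoint Q' * Q' = 1\<^sub>m (Suc n)"
    unfolding aQ' unfolding Q'_def using Qc QQ
    by (subst mult_four_block_mat[of _ 1 1 _ n _ n _ _ 1 _ n]) auto
  then have uQ': "unitary (Suc n) Q'" by (rule unitaryI[OF Q'])
  have "mat_adjoint Q' * B * Q' = four_block_mat (mat 1 1 (\<lambda>_. e)) (0\<^sub>m 1 n) (0\<^sub>m n 1) (mat_diag n f)"
  proof -
    have QC: "mat_adjoint Q * C \<in> carrier_mat n n" using Qc C by (simp add: square_mat_mult)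
    have "mat_adjoint Q' * B = four_block_mat (mat 1 1 (\<lambda>_. e)) (0\<^sub>m 1 n) (0\<^sub>m n 1) (mat_adjoint Q * C)"
      unfolding aQ' Bblock using Qc C QC
      by (subst mult_four_block_mat[of _ 1 1 _ n _ n _ _ 1 _ n]) auto
    then show ?thesis
      unfolding Q'_def using Qc QC Qd by (simp, subst mult_four_block_mat[of _ 1 1 _ n _ n _ _ 1 _ n]) auto
  qed
  \<comment> \<open>\<open>case_nat e f\<close> puts the eigenvalue split off here in front of those
    of the smaller block.\<close>
  also have "\<dots> = mat_diag (Suc n) (case_nat e f)"
    by (rule eq_matI) (auto simp: mat_diag_def split: nat.splits)
  also have "mat_adjoint Q' * B * Q' = mat_adjoint (U * Q') * A * (U * Q')"
    using A Uc Q' by (simp add: B_def square_mat_mult[of _ "Suc n"])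
  finally show ?case using unitary_mult[OF U uQ'] by blast
qed

subsection \<open>Singular value decomposition and the trace norm\<close>

text \<open>Vectors are plain functions of which the first \<open>n\<close> values matter, so linear
  combinations need no dimension bookkeeping. Conjugation sits on the first argument, to match the
  entries of a product with \<open>mat_adjoint\<close> on the left.\<close>

definition ip :: "nat \<Rightarrow> (nat \<Rightarrow> complex) \<Rightarrow> (nat \<Rightarrow> complex) \<Rightarrow> complex" where
  "ip n x y = (\<Sum>k<n. cnj (x k) * y k)"

definition sqnorm :: "nat \<Rightarrow> (nat \<Rightarrow> complex) \<Rightarrow> real" where
  "sqnorm n x = (\<Sum>k<n. (cmod (x k))\<^sup>2)"

lemma sqnorm_nonneg [simp]: "0 \<le> sqnorm n x"
  by (simp add: sqnorm_def sum_nonneg)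

lemma ip_self: "ip n x x = complex_of_real (sqnorm n x)"
  by (simp add: ip_def sqnorm_def complex_norm_square mult.commute del: of_real_power)

lemma cnj_ip: "cnj (ip n x y) = ip n y x"
  by (simp add: ip_def mult.commute)

lemma ip_diff_right: "ip n x (\<lambda>k. y k - z k) = ip n x y - ip n x z"
  by (simp add: ip_def right_diff_distrib sum_subtractf)

lemma ip_diff_left: "ip n (\<lambda>k. y k - z k) x = ip n y x - ip n z x"
  by (simp add: ip_def left_diff_distrib sum_subtractf)

lemma ip_sum_right: "ip n x (\<lambda>k. \<Sum>j\<in>J. c j * w j k) = (\<Sum>j\<in>J. c j * ip n x (w j))"
  unfolding ip_def sum_distrib_left by (subst sum.swap) (simp add: mult_ac)

lemma ip_scale_right: "ip n x (\<lambda>k. c * w k) = c * ip n x w"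
  unfolding ip_def sum_distrib_left by (simp add: mult_ac)

text \<open>Zero vectors are allowed, since a vanishing singular value determines no left singular
  vector.\<close>

definition subnormal_family :: "nat \<Rightarrow> nat \<Rightarrow> (nat \<Rightarrow> nat \<Rightarrow> complex) \<Rightarrow> bool" where
  "subnormal_family l n w \<longleftrightarrow>
     (\<forall>i<l. sqnorm n (w i) \<le> 1) \<and> (\<forall>i<l. \<forall>j<l. i \<noteq> j \<longrightarrow> ip n (w i) (w j) = 0)"

text \<open>Pythagoras. The lengths stay in the formula because it is also applied to columns whose
  lengths are singular values.\<close>

lemma sqnorm_orthogonal_sum:
  fixes l :: nat
  assumes orth: "\<And>i j. i < l \<Longrightarrow> j < l \<Longrightarrow> i \<noteq> j \<Longrightarrow> ip n (w i) (w j) = 0"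
  shows "sqnorm n (\<lambda>k. \<Sum>j<l. a j * w j k) = (\<Sum>j<l. (cmod (a j))\<^sup>2 * sqnorm n (w j))"
proof -
  define z where "z k = (\<Sum>j<l. a j * w j k)" for k
  have wz: "ip n (w j) z = a j * complex_of_real (sqnorm n (w j))" if j: "j < l" for j
  proof -
    have "ip n (w j) z = (\<Sum>i<l. a i * ip n (w j) (w i))" unfolding z_def ip_sum_right ..
    also have "\<dots> = (\<Sum>i<l. if i = j then a j * ip n (w j) (w j) else 0)"
      using orth j by (intro sum.cong) auto
    finally show ?thesis using j by (simp only: sum.delta finite_lessThan lessThan_iff if_True ip_self)
  qed
  have "ip n z z = (\<Sum>j<l. a j * ip n z (w j))"
    unfolding ip_sum_right[symmetric] by (simp add: z_def[abs_def])
  also have "\<dots> = (\<Sum>j<l. a j * cnj (a j * complex_of_real (sqnorm n (w j))))"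
    by (intro sum.cong) (simp_all add: wz[symmetric] cnj_ip)
  also have "\<dots> = complex_of_real (\<Sum>j<l. (cmod (a j))\<^sup>2 * sqnorm n (w j))"
    by (simp add: complex_norm_square mult_ac del: of_real_power)
  finally show ?thesis unfolding ip_self z_def[abs_def] of_real_eq_iff .
qed

text \<open>For a_j the inner products and z = \<Sum> a_j w_j, the inner product of x and z is S =
  \<Sum> |a_j|^2, while ||z||^2 \<le> S because the w_j have length at most 1. Hence 0 \<le> ||x -
  z||^2 = ||x||^2 - 2 S + ||z||^2 gives the bound, although z need not be a projection of x.\<close>

lemma bessel:
  assumes w: "subnormal_family l n w"
  shows "(\<Sum>j<l. (cmod (ip n (w j) x))\<^sup>2) \<le> sqnorm n x"
proof -
  define a where "a j = ip n (w j) x" for j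
  define z where "z k = (\<Sum>j<l. a j * w j k)" for k
  define S where "S = (\<Sum>j<l. (cmod (a j))\<^sup>2)"
  have xz: "ip n x z = complex_of_real S"
    unfolding z_def ip_sum_right S_def
    by (simp add: cnj_ip[of n _ x, symmetric] a_def[symmetric] complex_norm_square del: of_real_power)
  then have zx: "ip n z x = complex_of_real S"
    by (metis cnj_ip complex_cnj_complex_of_real)
  have "sqnorm n z = (\<Sum>j<l. (cmod (a j))\<^sup>2 * sqnorm n (w j))"
    unfolding z_def[abs_def] using w by (intro sqnorm_orthogonal_sum) (simp add: subnormal_family_def)
  also have "\<dots> \<le> S"
    unfolding S_def using w by (intro sum_mono) (auto simp: subnormal_family_def intro!: mult_left_le)
  finally have zz: "sqnorm n z \<le> S" .
  have "complex_of_real (sqnorm n (\<lambda>k. x k - z k)) = complex_of_real (sqnorm n x - S - S + sqnorm n z)"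
    unfolding ip_self[symmetric] ip_diff_left ip_diff_right xz zx
    by (simp add: ip_self)
  then have "0 \<le> sqnorm n x - S - S + sqnorm n z"
    using sqnorm_nonneg[of n "\<lambda>k. x k - z k"] unfolding of_real_eq_iff by linarith
  with zz show ?thesis unfolding S_def a_def by linarith
qed

text \<open>Cauchy-Schwarz, phrased for squared norms and with upper bounds in place of the two
  sums.\<close>

lemma sum_sqrt_mult_le:
  assumes "\<And>i. i \<in> I \<Longrightarrow> 0 \<le> A i" "\<And>i. i \<in> I \<Longrightarrow> 0 \<le> B i"
    and "(\<Sum>i\<in>I. A i) \<le> a" "(\<Sum>i\<in>I. B i) \<le> b"
  shows "(\<Sum>i\<in>I. sqrt (A i) * sqrt (B i)) \<le> sqrt a * sqrt b"
proof -
  have "(\<Sum>i\<in>I. sqrt (A i) * sqrt (B i)) = (\<Sum>i\<in>I. \<bar>sqrt (A i)\<bar> * \<bar>sqrt (B i)\<bar>)"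
    using assms(1,2) by (intro sum.cong) auto
  also have "\<dots> \<le> L2_set (\<lambda>i. sqrt (A i)) I * L2_set (\<lambda>i. sqrt (B i)) I"
    by (rule L2_set_mult_ineq)
  also have "\<dots> = sqrt (\<Sum>i\<in>I. A i) * sqrt (\<Sum>i\<in>I. B i)"
    using assms(1,2) by (simp add: L2_set_def)
  also have "\<dots> \<le> sqrt a * sqrt b"
    using assms by (intro mult_mono) (auto simp: sum_nonneg intro: order_trans[OF sum_nonneg])
  finally show ?thesis .
qed

section \<open>Singular values from the Gram matrix\<close>

lemma proots_linear_factors: "proots (\<Prod>a\<leftarrow>as. [:- a, 1:]) = mset (as :: complex list)"
proof (induction as)
  case (Cons a as)
  have "(\<Prod>a\<leftarrow>as. [:- a, 1:]) \<noteq> 0" by (auto simp: prod_list_zero_iff)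
  with Cons show ?case by (simp add: proots_mult del: mult_pCons_left)
qed simp

text \<open>Diagonalizing \<open>mat_adjoint T * T\<close> makes the columns of \<open>T * Q\<close>
  orthogonal, with the singular values as lengths. The rectangular form serves both the
  decomposition of a square input and the polar factor of the code matrix.\<close>

lemma gram_diagonalization:
  assumes T: "T \<in> carrier_mat n l"
  shows "\<exists>Q s. unitary l Q \<and> (\<forall>j. 0 \<le> s j) \<and>
    mat_adjoint (T * Q) * (T * Q) = mat_diag l (\<lambda>j. complex_of_real ((s j)\<^sup>2)) \<and>
    singular_values T = image_mset s (mset_set {..<l})"
proof -
  define H where "H = mat_adjoint T * T"
  have H: "H \<in> carrier_mat l l" using T by (auto simp: H_def)
  have "mat_adjoint H = H" using T by (simp add: H_def adjoint_mult[of _ l n _ l])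
  then obtain Q f where Q: "unitary l Q" and D: "mat_adjoint Q * H * Q = mat_diag l f"
    using hermitian_diagonalization[OF H] by blast
  have Qc: "Q \<in> carrier_mat l l" and QQ: "mat_adjoint Q * Q = 1\<^sub>m l" "Q * mat_adjoint Q = 1\<^sub>m l"
    using Q by (auto simp: unitary_def)
  \<comment> \<open>Taken as column lengths, the values are nonnegative at every index, also from
    \<open>l\<close> on.\<close>
  define s where "s j = sqrt (sqnorm n (\<lambda>p. (T * Q) $$ (p, j)))" for j
  have TQ: "T * Q \<in> carrier_mat n l" using T Qc by simp
  have gram: "mat_adjoint (T * Q) * (T * Q) = mat_diag l f"
  proof -
    have aT: "mat_adjoint T \<in> carrier_mat l n" and aQ: "mat_adjoint Q \<in> carrier_mat l l"
      using T Qc by auto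
    have "mat_adjoint (T * Q) * (T * Q) = mat_adjoint Q * mat_adjoint T * (T * Q)"
      using T Qc by (simp add: adjoint_mult)
    also have "\<dots> = mat_adjoint Q * (mat_adjoint T * (T * Q))"
      using assoc_mult_mat[OF aQ aT TQ] .
    also have "\<dots> = mat_adjoint Q * (H * Q)"
      using assoc_mult_mat[OF aT T Qc] by (simp add: H_def)
    also have "\<dots> = mat_adjoint Q * H * Q" using assoc_mult_mat[OF aQ H Qc] by simp
    finally show ?thesis using D by simp
  qed
  have f: "f j = complex_of_real ((s j)\<^sup>2)" if "j < l" for j
  proof -
    have "f j = (mat_adjoint (T * Q) * (T * Q)) $$ (j, j)" using that by (simp add: gram mat_diag_def)
    also have "\<dots> = ip n (\<lambda>p. (T * Q) $$ (p, j)) (\<lambda>p. (T * Q) $$ (p, j))"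
      unfolding ip_def using adjoint_mult_index[OF TQ TQ that that] .
    finally show ?thesis by (simp add: ip_self s_def)
  qed
  have diag: "mat_diag l f = mat_diag l (\<lambda>j. complex_of_real ((s j)\<^sup>2))"
    by (rule eq_matI) (auto simp: mat_diag_def f)
  have "Q * mat_diag l f * mat_adjoint Q = (Q * mat_adjoint Q) * H * (Q * mat_adjoint Q)"
    using Qc H by (simp add: D[symmetric] square_mat_mult[of _ l])
  \<comment> \<open>Similarity preserves the characteristic polynomial, so its roots with
    multiplicity are the diagonal entries.\<close>
  then have "similar_mat_wit H (mat_diag l f) Q (mat_adjoint Q)"
    using Qc H QQ by (intro similar_mat_witI[of _ _ l]) auto
  then have "char_poly H = char_poly (mat_diag l f)"
    by (intro char_poly_similar) (auto simp: similar_mat_def)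
  also have "\<dots> = (\<Prod>a\<leftarrow>diag_mat (mat_diag l f). [:- a, 1:])"
    by (rule char_poly_upper_triangular[of _ l]) (auto simp: mat_diag_def)
  also have "diag_mat (mat_diag l f) = map f [0..<l]"
    by (auto simp: diag_mat_def mat_diag_def)
  finally have "proots (char_poly H) = image_mset f (mset_set {..<l})"
    by (simp only: proots_linear_factors mset_map mset_upt atLeast0LessThan)
  then have "singular_values T = image_mset (\<lambda>j. sqrt (Re (f j))) (mset_set {..<l})"
    by (simp add: singular_values_def H_def[symmetric] multiset.map_comp o_def)
  also have "\<dots> = image_mset s (mset_set {..<l})"
    by (intro image_mset_cong) (auto simp: f, auto simp: s_def)
  finally have "singular_values T = image_mset s (mset_set {..<l})" .
  then show ?thesis using Q gram diag by (intro exI[of _ Q] exI[of _ s]) (auto simp: s_def)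
qed

text \<open>The right vectors are the columns of the diagonalizing unitary, the left vectors their
  rescaled images. The formula for s_t as a matrix element is what turns any other expansion of a
  matrix into a bound on its trace norm.\<close>

theorem singular_value_decomposition:
  assumes X: "X \<in> carrier_mat n n"
  shows "\<exists>s w q. (\<forall>t. 0 \<le> s t) \<and> subnormal_family n n w \<and> subnormal_family n n q \<and>
    (\<forall>i<n. \<forall>j<n. X $$ (i, j) = (\<Sum>t<n. complex_of_real (s t) * w t i * cnj (q t j))) \<and>
    (\<forall>t<n. complex_of_real (s t) = (\<Sum>i<n. \<Sum>j<n. cnj (w t i) * X $$ (i, j) * q t j)) \<and>
    trace_norm X = (\<Sum>t<n. s t)"
proof -
  obtain Q s where Q: "unitary n Q" and s: "\<And>j. 0 \<le> s j"
    and gram: "mat_adjoint (X * Q) * (X * Q) = mat_diag n (\<lambda>j. complex_of_real ((s j)\<^sup>2))"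
    and sv: "singular_values X = image_mset s (mset_set {..<n})"
    using gram_diagonalization[OF X] by blast
  have Qc: "Q \<in> carrier_mat n n" and QQ: "mat_adjoint Q * Q = 1\<^sub>m n" "Q * mat_adjoint Q = 1\<^sub>m n"
    using Q by (auto simp: unitary_def)
  define B where "B = X * Q"
  have B: "B \<in> carrier_mat n n" using X Qc by (simp add: B_def)
  have ipB: "ip n (\<lambda>p. B $$ (p, i)) (\<lambda>p. B $$ (p, j)) = (if i = j then complex_of_real ((s j)\<^sup>2) else 0)"
    if "i < n" "j < n" for i j
    unfolding ip_def adjoint_mult_index[OF B B that, symmetric]
    using that by (simp add: B_def gram mat_diag_def)
  define q where "q t k = Q $$ (k, t)" for t k
  define w where "w t k = (if s t = 0 then 0 else 1 / complex_of_real (s t)) * B $$ (k, t)" for t k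
  have qip: "ip n (q i) (q j) = (if i = j then 1 else 0)" if "i < n" "j < n" for i j
    unfolding ip_def q_def adjoint_mult_index[OF Qc Qc that, symmetric] QQ using that by simp
  have wip: "ip n (w i) (w j) = (if i = j \<and> s i \<noteq> 0 then 1 else 0)" if "i < n" "j < n" for i j
  proof -
    have "ip n (w i) (w j) = cnj (if s i = 0 then 0 else 1 / complex_of_real (s i)) *
        (if s j = 0 then 0 else 1 / complex_of_real (s j)) *
        ip n (\<lambda>p. B $$ (p, i)) (\<lambda>p. B $$ (p, j))"
      by (simp add: ip_def w_def sum_distrib_left mult_ac)
    then show ?thesis using that by (simp add: ipB power2_eq_square)
  qed
  \<comment> \<open>If s_t = 0, the column has squared length s_t^2 = 0, so a zero left vector
    represents it correctly.\<close>
  have Bw: "B $$ (i, t) = complex_of_real (s t) * w t i" if "i < n" "t < n" for i t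
  proof (cases "s t = 0")
    case True
    then have "sqnorm n (\<lambda>p. B $$ (p, t)) = 0"
      using ipB[OF that(2,2)] by (simp add: ip_self)
    then have "B $$ (i, t) = 0" using that by (simp add: sqnorm_def sum_nonneg_eq_0_iff)
    then show ?thesis using True by simp
  qed (simp add: w_def)
  have "X = B * mat_adjoint Q" using X Qc QQ by (simp add: B_def square_mat_mult[of _ n])
  then have X_eq: "X $$ (i, j) = (\<Sum>t<n. B $$ (i, t) * cnj (Q $$ (j, t)))" if "i < n" "j < n" for i j
    using mult_mat_index[OF B adjoint_carrier[OF Qc] that] that Qc by simp
  have st: "complex_of_real (s t) = (\<Sum>i<n. \<Sum>j<n. cnj (w t i) * X $$ (i, j) * q t j)" if t: "t < n" for t
  proof -
    have "(\<Sum>i<n. \<Sum>j<n. cnj (w t i) * X $$ (i, j) * q t j) = (\<Sum>i<n. cnj (w t i) * B $$ (i, t))"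
      using t by (intro sum.cong)
        (simp_all add: B_def mult_mat_index[OF X Qc] q_def sum_distrib_left mult_ac del: index_mult_mat)
    also have "\<dots> = ip n (w t) (\<lambda>k. complex_of_real (s t) * w t k)"
      unfolding ip_def by (intro sum.cong) (simp_all add: Bw t)
    also have "\<dots> = complex_of_real (s t)" unfolding ip_scale_right using wip[OF t t] by simp
    finally show ?thesis ..
  qed
  have sw: "subnormal_family n n w"
    unfolding subnormal_family_def
  proof (intro conjI allI impI)
    fix i assume "i < n"
    then have "complex_of_real (sqnorm n (w i)) = (if s i \<noteq> 0 then 1 else 0)"
      using wip[of i i] by (simp add: ip_self)
    then show "sqnorm n (w i) \<le> 1" by (cases "s i = 0") auto
  qed (use wip in auto)
  have sq: "subnormal_family n n q"
    unfolding subnormal_family_def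
  proof (intro conjI allI impI)
    fix i assume "i < n"
    then have "complex_of_real (sqnorm n (q i)) = 1"
      using qip[of i i] by (simp add: ip_self)
    then show "sqnorm n (q i) \<le> 1" by simp
  qed (use qip in auto)
  have tn: "trace_norm X = (\<Sum>t<n. s t)"
    by (simp add: trace_norm_def sv sum_unfold_sum_mset)
  have sX: "X $$ (i, j) = (\<Sum>t<n. complex_of_real (s t) * w t i * cnj (q t j))"
    if "i < n" "j < n" for i j
    using that by (simp add: X_eq Bw q_def)
  show ?thesis
    by (intro exI[of _ s] exI[of _ w] exI[of _ q] conjI allI impI)
      (rule s sw sq sX st tn; assumption)+
qed

text \<open>A triangle inequality obtained without duality: the expansion is substituted into the
  matrix element that gives each singular value. For each rank one term, Cauchy-Schwarz over the
  singular vectors and Bessel for both families leave the product of the two lengths.\<close>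

lemma trace_norm_sum_rank1_le:
  assumes Y: "Y \<in> carrier_mat n n"
    and eq: "\<And>i j. i < n \<Longrightarrow> j < n \<Longrightarrow> Y $$ (i, j) = (\<Sum>t\<in>I. x t i * cnj (y t j))"
  shows "trace_norm Y \<le> (\<Sum>t\<in>I. sqrt (sqnorm n (x t)) * sqrt (sqnorm n (y t)))"
proof -
  obtain s w q where s: "\<And>j. 0 \<le> s j" and w: "subnormal_family n n w" and q: "subnormal_family n n q"
    and sY: "\<And>t. t < n \<Longrightarrow> complex_of_real (s t) = (\<Sum>i<n. \<Sum>j<n. cnj (w t i) * Y $$ (i, j) * q t j)"
    and tn: "trace_norm Y = (\<Sum>t<n. s t)"
    using singular_value_decomposition[OF Y] by blast
  have sj: "complex_of_real (s j) = (\<Sum>t\<in>I. ip n (w j) (x t) * cnj (ip n (q j) (y t)))" if "j < n" for j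
  proof -
    have "complex_of_real (s j) =
        (\<Sum>i<n. \<Sum>k<n. \<Sum>t\<in>I. cnj (w j i) * x t i * (cnj (y t k) * q j k))"
      unfolding sY[OF that] by (intro sum.cong) (simp_all add: eq sum_distrib_left sum_distrib_right mult_ac)
    also have "\<dots> = (\<Sum>i<n. \<Sum>t\<in>I. \<Sum>k<n. cnj (w j i) * x t i * (cnj (y t k) * q j k))"
      by (intro sum.cong refl sum.swap)
    also have "\<dots> = (\<Sum>t\<in>I. \<Sum>i<n. \<Sum>k<n. cnj (w j i) * x t i * (cnj (y t k) * q j k))"
      by (rule sum.swap)
    also have "\<dots> = (\<Sum>t\<in>I. ip n (w j) (x t) * cnj (ip n (q j) (y t)))"
      unfolding cnj_ip by (simp add: ip_def sum_product)
    finally show ?thesis .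
  qed
  have "trace_norm Y = cmod (complex_of_real (\<Sum>j<n. s j))"
    using s by (simp add: tn sum_nonneg del: of_real_sum)
  also have "\<dots> = cmod (\<Sum>j<n. \<Sum>t\<in>I. ip n (w j) (x t) * cnj (ip n (q j) (y t)))"
    by (simp add: sj)
  also have "\<dots> \<le> (\<Sum>j<n. \<Sum>t\<in>I. cmod (ip n (w j) (x t)) * cmod (ip n (q j) (y t)))"
    by (intro order_trans[OF norm_sum] sum_mono) (simp add: norm_mult)
  also have "\<dots> = (\<Sum>t\<in>I. \<Sum>j<n. sqrt ((cmod (ip n (w j) (x t)))\<^sup>2) * sqrt ((cmod (ip n (q j) (y t)))\<^sup>2))"
    by (subst sum.swap) simp
  also have "\<dots> \<le> (\<Sum>t\<in>I. sqrt (sqnorm n (x t)) * sqrt (sqnorm n (y t)))"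
    by (intro sum_mono sum_sqrt_mult_le bessel w q) auto
  finally show ?thesis .
qed

subsection \<open>Kraus operators and the diamond norm\<close>

definition mapply :: "complex mat \<Rightarrow> (nat \<Rightarrow> complex) \<Rightarrow> nat \<Rightarrow> complex" where
  "mapply A x i = (\<Sum>k<dim_col A. A $$ (i, k) * x k)"

text \<open>If \<open>h\<close> acts on $\mathbf{C}^d$, then \<open>ampliate r h\<close> is $h \otimes \mathrm{id}$ on
  $\mathbf{C}^d \otimes \mathbf{C}^r$.\<close>

definition ampliate ::
  "nat \<Rightarrow> ((nat \<Rightarrow> complex) \<Rightarrow> nat \<Rightarrow> complex) \<Rightarrow> (nat \<Rightarrow> complex) \<Rightarrow> nat \<Rightarrow> complex" where
  "ampliate r h x p = h (\<lambda>k. x (k * r + p mod r)) (p div r)"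

lemma sum_lessThan_mult:
  fixes f :: "nat \<Rightarrow> 'a::comm_monoid_add"
  shows "(\<Sum>p<d * r. f p) = (\<Sum>k<d. \<Sum>a<r. f (k * r + a))"
proof -
  have "(\<Sum>p<d * r. f p) = (\<Sum>k<d. sum f {k * r..<k * r + r})"
    by (rule sum.nat_group[symmetric])
  also have "\<dots> = (\<Sum>k<d. \<Sum>a<r. f (k * r + a))"
  proof (rule sum.cong[OF refl])
    fix k
    show "sum f {k * r..<k * r + r} = (\<Sum>a<r. f (k * r + a))"
      using sum.shift_bounds_nat_ivl[of f 0 "k * r" r] by (simp add: add.commute atLeast0LessThan)
  qed
  finally show ?thesis .
qed

lemma sum_triple:
  "(\<Sum>c\<in>I. \<Sum>t\<in>J. \<Sum>b\<in>B. f ((c, t), b)) = (\<Sum>z\<in>(I \<times> J) \<times> B. f z)"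
  by (simp only: sum.cartesian_product[of "\<lambda>z b. f (z, b)", simplified, symmetric]
      sum.cartesian_product[of "\<lambda>c t. \<Sum>b\<in>B. f ((c, t), b)", simplified, symmetric] split_def prod.collapse)

lemma sqnorm_slices: "sqnorm (d * r) x = (\<Sum>a<r. sqnorm d (\<lambda>k. x (k * r + a)))"
  unfolding sqnorm_def sum_lessThan_mult by (rule sum.swap)

lemma sqnorm_ampliate:
  "sqnorm (e * r) (ampliate r h x) = (\<Sum>a<r. sqnorm e (h (\<lambda>k. x (k * r + a))))"
  unfolding sqnorm_slices by (intro sum.cong) (auto simp: ampliate_def sqnorm_def)

text \<open>The slices of the ancilla are transformed independently and squared norms add over them,
  so the constant does not grow with \<open>r\<close>. This makes an estimate on C^d sufficient for
  the diamond norm.\<close>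

lemma sum_sqnorm_ampliate_le:
  assumes "\<And>x. (\<Sum>c\<in>I. sqnorm e (h c x)) \<le> \<beta> * sqnorm d x"
  shows "(\<Sum>c\<in>I. sqnorm (e * r) (ampliate r (h c) x)) \<le> \<beta> * sqnorm (d * r) x"
proof -
  have "(\<Sum>c\<in>I. sqnorm (e * r) (ampliate r (h c) x)) =
      (\<Sum>a<r. \<Sum>c\<in>I. sqnorm e (h c (\<lambda>k. x (k * r + a))))"
    by (simp only: sqnorm_ampliate) (rule sum.swap)
  also have "\<dots> \<le> (\<Sum>a<r. \<beta> * sqnorm d (\<lambda>k. x (k * r + a)))"
    by (intro sum_mono assms)
  finally show ?thesis by (simp only: sqnorm_slices sum_distrib_left)
qed

lemma sandwich_index:
  fixes F X :: "complex mat"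
  assumes "F \<in> carrier_mat e d" "X \<in> carrier_mat d d" "i < e" "j < e"
  shows "(F * X * mat_adjoint F) $$ (i, j) =
    (\<Sum>k<d. \<Sum>l<d. F $$ (i, k) * X $$ (k, l) * cnj (F $$ (j, l)))"
proof -
  have "(F * X * mat_adjoint F) $$ (i, j) = (\<Sum>l<d. (\<Sum>k<d. F $$ (i, k) * X $$ (k, l)) * cnj (F $$ (j, l)))"
    using assms by (simp add: mult_mat_index[of "F * X" e d _ e] mult_mat_index[of F e d X d] del: index_mult_mat(1))
  also have "\<dots> = (\<Sum>k<d. \<Sum>l<d. F $$ (i, k) * X $$ (k, l) * cnj (F $$ (j, l)))"
    unfolding sum_distrib_right by (rule sum.swap)
  finally show ?thesis .
qed

lemma mult_add_less_mult:
  fixes a k d r :: nat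
  assumes "k < d" "a < r"
  shows "k * r + a < d * r"
proof -
  have "k * r + a < Suc k * r" using assms by simp
  also have "\<dots> \<le> d * r" using assms by (intro mult_le_mono1) simp
  finally show ?thesis .
qed

text \<open>By linearity, F \<otimes> 1 sends each rank one term of a decomposition to the rank one
  term built from the two image vectors; this is read off at one entry.\<close>

lemma sandwich_slice_index:
  fixes F X :: "complex mat"
  assumes F: "F \<in> carrier_mat e d" and X: "X \<in> carrier_mat (d * r) (d * r)"
    and dec: "\<And>i j. i < d * r \<Longrightarrow> j < d * r \<Longrightarrow>
      X $$ (i, j) = (\<Sum>t\<in>J. complex_of_real (s t) * w t i * cnj (q t j))"
    and ij: "i < e * r" "j < e * r"
  shows "(F * mat d d (\<lambda>(k, l). X $$ (k * r + i mod r, l * r + j mod r)) * mat_adjoint F)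
      $$ (i div r, j div r) =
    (\<Sum>t\<in>J. complex_of_real (s t) * ampliate r (mapply F) (w t) i * cnj (ampliate r (mapply F) (q t) j))"
proof -
  have r: "0 < r" using ij by (cases r) auto
  have m: "i mod r < r" "j mod r < r" using r by auto
  have dv: "i div r < e" "j div r < e" using ij by (auto simp: less_mult_imp_div_less)
  have "(F * mat d d (\<lambda>(k, l). X $$ (k * r + i mod r, l * r + j mod r)) * mat_adjoint F)
      $$ (i div r, j div r) =
    (\<Sum>k<d. \<Sum>l<d. \<Sum>t\<in>J. complex_of_real (s t) * (F $$ (i div r, k) * w t (k * r + i mod r)) *
      cnj (F $$ (j div r, l) * q t (l * r + j mod r)))"
    using dv m by (subst sandwich_index[OF F _ dv])
      (auto simp: dec mult_add_less_mult sum_distrib_left sum_distrib_right mult_ac intro!: sum.cong)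
  also have "\<dots> = (\<Sum>k<d. \<Sum>t\<in>J. \<Sum>l<d. complex_of_real (s t) * (F $$ (i div r, k) * w t (k * r + i mod r)) *
      cnj (F $$ (j div r, l) * q t (l * r + j mod r)))"
    by (intro sum.cong refl sum.swap)
  also have "\<dots> = (\<Sum>t\<in>J. \<Sum>k<d. \<Sum>l<d. complex_of_real (s t) * (F $$ (i div r, k) * w t (k * r + i mod r)) *
      cnj (F $$ (j div r, l) * q t (l * r + j mod r)))"
    by (rule sum.swap)
  also have "\<dots> = (\<Sum>t\<in>J. complex_of_real (s t) * ampliate r (mapply F) (w t) i *
      cnj (ampliate r (mapply F) (q t) j))"
    by (intro sum.cong refl, simp only: ampliate_def mapply_def carrier_matD[OF F] cnj_sum sum_product mult.assoc)
      (simp only: sum_distrib_left mult.assoc)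
  finally show ?thesis .
qed

text \<open>The empty family of rank one terms expands the zero matrix. The bound makes this matrix
  a member witnessing that the supremum in \<open>diamond_norm\<close> is over a nonempty
  set.\<close>

lemma trace_norm_zero_mat: "trace_norm (0\<^sub>m n n) \<le> 0"
  using trace_norm_sum_rank1_le[of "0\<^sub>m n n" n _ _ "{} :: nat set"] by simp

text \<open>Each difference $F \rho F^* - G \rho G^*$ splits as
  $(F - G) \rho F^* + G \rho (F - G)^*$, so that the Cauchy-Schwarz inequality applies to the
  vectors in a singular value decomposition of \<open>\<rho>\<close>.\<close>

theorem diamond_norm_kraus_difference_le:
  assumes F: "\<And>c. c \<in> I \<Longrightarrow> F c \<in> carrier_mat e d" and G: "\<And>c. c \<in> I \<Longrightarrow> G c \<in> carrier_mat e d"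
    and \<Phi>: "\<And>\<rho> i j. \<rho> \<in> carrier_mat d d \<Longrightarrow> i < e \<Longrightarrow> j < e \<Longrightarrow> \<Phi> \<rho> $$ (i, j) =
      (\<Sum>c\<in>I. (F c * \<rho> * mat_adjoint (F c)) $$ (i, j) - (G c * \<rho> * mat_adjoint (G c)) $$ (i, j))"
    and nF: "\<And>x. (\<Sum>c\<in>I. sqnorm e (mapply (F c) x)) \<le> sqnorm d x"
    and nG: "\<And>x. (\<Sum>c\<in>I. sqnorm e (mapply (G c) x)) \<le> sqnorm d x"
    and nD: "\<And>x. (\<Sum>c\<in>I. sqnorm e (\<lambda>i. mapply (F c) x i - mapply (G c) x i)) \<le> \<delta>\<^sup>2 * sqnorm d x"
    and \<delta>: "0 \<le> \<delta>"
  shows "diamond_norm d e \<Phi> \<le> 2 * \<delta>"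
proof -
  have main: "trace_norm (tensor_id r d e \<Phi> X) \<le> 2 * \<delta>"
    if X: "X \<in> carrier_mat (d * r) (d * r)" and X1: "trace_norm X \<le> 1" for r X
  proof -
    define n where "n = d * r"
    obtain s w q where s: "\<And>j. 0 \<le> s j" and w: "subnormal_family n n w" and q: "subnormal_family n n q"
      and dec': "\<And>i j. i < n \<Longrightarrow> j < n \<Longrightarrow>
        X $$ (i, j) = (\<Sum>t<n. complex_of_real (s t) * w t i * cnj (q t j))"
      and tn: "trace_norm X = (\<Sum>t<n. s t)"
      using singular_value_decomposition[OF X[folded n_def]] by blast
    have dec: "X $$ (i, j) = (\<Sum>t<n. complex_of_real (s t) * w t i * cnj (q t j))"
      if "i < d * r" "j < d * r" for i j
      using dec'[of i j] that by (simp add: n_def)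
    have w1: "sqnorm (d * r) (w t) \<le> 1" and q1: "sqnorm (d * r) (q t) \<le> 1" if "t < n" for t
      using w q that by (auto simp: subnormal_family_def n_def)
    define f where "f c = ampliate r (mapply (F c))" for c
    define g where "g c = ampliate r (mapply (G c))" for c
    define h where "h c = ampliate r (\<lambda>x i. mapply (F c) x i - mapply (G c) x i)" for c
    have h: "h c x p = f c x p - g c x p" for c x p by (simp add: h_def f_def g_def ampliate_def)
    have bf: "(\<Sum>c\<in>I. sqnorm (e * r) (f c x)) \<le> 1" if "sqnorm (d * r) x \<le> 1" for x
      using sum_sqnorm_ampliate_le[of e "\<lambda>c. mapply (F c)" I 1 d r x] nF that by (simp add: f_def)
    have bg: "(\<Sum>c\<in>I. sqnorm (e * r) (g c x)) \<le> 1" if "sqnorm (d * r) x \<le> 1" for x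
      using sum_sqnorm_ampliate_le[of e "\<lambda>c. mapply (G c)" I 1 d r x] nG that by (simp add: g_def)
    have bh: "(\<Sum>c\<in>I. sqnorm (e * r) (h c x)) \<le> \<delta>\<^sup>2" if "sqnorm (d * r) x \<le> 1" for x
    proof -
      have "(\<Sum>c\<in>I. sqnorm (e * r) (h c x)) \<le> \<delta>\<^sup>2 * sqnorm (d * r) x"
        unfolding h_def by (intro sum_sqnorm_ampliate_le nD)
      also have "\<dots> \<le> \<delta>\<^sup>2" using that by (simp add: mult_left_le)
      finally show ?thesis .
    qed
    define Y where "Y = tensor_id r d e \<Phi> X"
    have Y: "Y \<in> carrier_mat (e * r) (e * r)" by (simp add: Y_def tensor_id_def)
    \<comment> \<open>The flag \<open>b\<close> selects the summand of the split difference: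
      \<open>True\<close> pairs \<open>h c (w t)\<close> with \<open>f c (q t)\<close>, and
      \<open>False\<close> pairs \<open>g c (w t)\<close> with \<open>h c (q t)\<close>. The weight
      s_t is carried by \<open>x\<close>.\<close>
    define x where "x = (\<lambda>((c, t), b) i. complex_of_real (s t) * (if b then h c (w t) i else g c (w t) i))"
    define y where "y = (\<lambda>((c, t), b). if b then f c (q t) else h c (q t))"
    have "Y $$ (i, j) = (\<Sum>z\<in>(I \<times> {..<n}) \<times> (UNIV :: bool set). x z i * cnj (y z j))"
      if ij: "i < e * r" "j < e * r" for i j
    proof -
      define R where "R = mat d d (\<lambda>(k, l). X $$ (k * r + i mod r, l * r + j mod r))"
      have R: "R \<in> carrier_mat d d" by (simp add: R_def)
      have dv: "i div r < e" "j div r < e" using ij by (auto simp: less_mult_imp_div_less)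
      have "Y $$ (i, j) = \<Phi> R $$ (i div r, j div r)"
        using ij by (simp add: Y_def tensor_id_def R_def)
      also have "\<dots> = (\<Sum>c\<in>I. (\<Sum>t<n. complex_of_real (s t) * f c (w t) i * cnj (f c (q t) j)) -
          (\<Sum>t<n. complex_of_real (s t) * g c (w t) i * cnj (g c (q t) j)))"
        unfolding \<Phi>[OF R dv] unfolding R_def f_def g_def
        by (intro sum.cong refl arg_cong2[where f = "(-)"] sandwich_slice_index[where e = e] F G X dec ij)
      also have "\<dots> = (\<Sum>c\<in>I. \<Sum>t<n. \<Sum>b\<in>UNIV. x ((c, t), b) i * cnj (y ((c, t), b) j))"
        unfolding sum_subtractf[symmetric]
        by (intro sum.cong refl) (simp add: x_def y_def h UNIV_bool algebra_simps)
      also have "\<dots> = (\<Sum>z\<in>(I \<times> {..<n}) \<times> (UNIV :: bool set). x z i * cnj (y z j))"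
        by (rule sum_triple)
      finally show ?thesis .
    qed
    then have "trace_norm Y \<le> (\<Sum>z\<in>(I \<times> {..<n}) \<times> (UNIV :: bool set).
        sqrt (sqnorm (e * r) (x z)) * sqrt (sqnorm (e * r) (y z)))"
      by (rule trace_norm_sum_rank1_le[OF Y])
    also have "\<dots> = (\<Sum>c\<in>I. \<Sum>t<n. \<Sum>b\<in>UNIV. sqrt (sqnorm (e * r) (x ((c, t), b))) * sqrt (sqnorm (e * r) (y ((c, t), b))))"
      by (rule sum_triple[symmetric])
    also have "\<dots> = (\<Sum>t<n. \<Sum>c\<in>I. \<Sum>b\<in>UNIV. sqrt (sqnorm (e * r) (x ((c, t), b))) * sqrt (sqnorm (e * r) (y ((c, t), b))))"
      by (rule sum.swap)
    also have "\<dots> = (\<Sum>t<n. s t * ((\<Sum>c\<in>I. sqrt (sqnorm (e * r) (h c (w t))) * sqrt (sqnorm (e * r) (f c (q t)))) +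
        (\<Sum>c\<in>I. sqrt (sqnorm (e * r) (g c (w t))) * sqrt (sqnorm (e * r) (h c (q t))))))"
    proof -
      have "sqrt (sqnorm (e * r) (\<lambda>i. complex_of_real (s t) * v i)) = s t * sqrt (sqnorm (e * r) v)" for t v
        using s by (simp add: sqnorm_def norm_mult power_mult_distrib real_sqrt_mult sum_distrib_left[symmetric])
      then show ?thesis
        by (intro sum.cong refl) (simp add: x_def y_def UNIV_bool sum.distrib sum_distrib_left distrib_left mult.assoc)
    qed
    \<comment> \<open>Cauchy-Schwarz over the Kraus index for each t: in both summands the factor
      with \<open>h\<close> is at most \<delta> and the other at most 1.\<close>
    also have "\<dots> \<le> (\<Sum>t<n. s t * (sqrt (\<delta>\<^sup>2) * sqrt 1 + sqrt 1 * sqrt (\<delta>\<^sup>2)))"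
      by (intro sum_mono mult_left_mono add_mono sum_sqrt_mult_le bf bg bh w1 q1 s) auto
    also have "\<dots> = 2 * \<delta> * trace_norm X"
      using \<delta> by (simp add: tn sum_distrib_left mult_ac)
    also have "\<dots> \<le> 2 * \<delta>" using X1 \<delta> by (simp add: mult_left_le)
    finally show ?thesis by (simp add: Y_def)
  qed
  have "trace_norm (0\<^sub>m (d * 1) (d * 1)) \<le> 1" using trace_norm_zero_mat[of "d * 1"] by simp
  then have "{trace_norm (tensor_id r d e \<Phi> X) | r X.
     1 \<le> r \<and> X \<in> carrier_mat (d * r) (d * r) \<and> trace_norm X \<le> 1} \<noteq> {}"
    by (auto intro!: exI[of _ 1] exI[of _ "0\<^sub>m (d * 1) (d * 1)"])
  then show ?thesis unfolding diamond_norm_def by (intro cSup_least) (auto intro: main)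
qed

section \<open>Trace preservation and complete positivity of Kraus maps\<close>

definition kraus_normalized :: "nat \<Rightarrow> nat \<Rightarrow> 'i set \<Rightarrow> ('i \<Rightarrow> complex mat) \<Rightarrow> bool" where
  "kraus_normalized d e I D \<longleftrightarrow> (\<forall>b\<in>I. D b \<in> carrier_mat e d) \<and>
     (\<forall>k<d. \<forall>l<d. (\<Sum>b\<in>I. \<Sum>i<e. cnj (D b $$ (i, k)) * D b $$ (i, l)) = (if k = l then 1 else 0))"

text \<open>Stacking the operators gives one matrix with orthonormal columns, hence an isometry. The
  index type is arbitrary so that single isometries, numbered noise operators and the decoder on a
  sum type are all covered.\<close>

lemma kraus_normalized_sqnorm:
  assumes "kraus_normalized d e I D"
  shows "(\<Sum>b\<in>I. sqnorm e (mapply (D b) x)) = sqnorm d x"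
proof -
  have D: "\<And>b. b \<in> I \<Longrightarrow> D b \<in> carrier_mat e d"
    and norm: "\<And>k l. k < d \<Longrightarrow> l < d \<Longrightarrow>
      (\<Sum>b\<in>I. \<Sum>i<e. cnj (D b $$ (i, k)) * D b $$ (i, l)) = (if k = l then 1 else 0)"
    using assms by (auto simp: kraus_normalized_def)
  have one: "complex_of_real (sqnorm e (mapply (D b) x)) =
      (\<Sum>k<d. \<Sum>l<d. cnj (x k) * x l * (\<Sum>i<e. cnj (D b $$ (i, k)) * D b $$ (i, l)))" if b: "b \<in> I" for b
  proof -
    have "complex_of_real (sqnorm e (mapply (D b) x)) =
        (\<Sum>i<e. \<Sum>k<d. \<Sum>l<d. cnj (x k) * x l * (cnj (D b $$ (i, k)) * D b $$ (i, l)))"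
      by (simp only: ip_self[symmetric] ip_def mapply_def carrier_matD[OF D[OF b]] cnj_sum sum_product)
        (simp add: mult_ac)
    also have "\<dots> = (\<Sum>k<d. \<Sum>i<e. \<Sum>l<d. cnj (x k) * x l * (cnj (D b $$ (i, k)) * D b $$ (i, l)))"
      by (rule sum.swap)
    also have "\<dots> = (\<Sum>k<d. \<Sum>l<d. \<Sum>i<e. cnj (x k) * x l * (cnj (D b $$ (i, k)) * D b $$ (i, l)))"
      by (intro sum.cong refl sum.swap)
    finally show ?thesis by (simp add: sum_distrib_left)
  qed
  have "complex_of_real (\<Sum>b\<in>I. sqnorm e (mapply (D b) x)) =
      (\<Sum>b\<in>I. \<Sum>k<d. \<Sum>l<d. cnj (x k) * x l * (\<Sum>i<e. cnj (D b $$ (i, k)) * D b $$ (i, l)))"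
    by (simp add: one)
  also have "\<dots> = (\<Sum>k<d. \<Sum>b\<in>I. \<Sum>l<d. cnj (x k) * x l * (\<Sum>i<e. cnj (D b $$ (i, k)) * D b $$ (i, l)))"
    by (rule sum.swap)
  also have "\<dots> = (\<Sum>k<d. \<Sum>l<d. \<Sum>b\<in>I. cnj (x k) * x l * (\<Sum>i<e. cnj (D b $$ (i, k)) * D b $$ (i, l)))"
    by (intro sum.cong refl sum.swap)
  also have "\<dots> = (\<Sum>k<d. \<Sum>l<d. cnj (x k) * x l * (if k = l then 1 else 0))"
    by (intro sum.cong refl) (simp add: sum_distrib_left[symmetric] norm)
  also have "\<dots> = (\<Sum>k<d. cnj (x k) * x k)" by (simp add: mult.assoc if_distrib cong: if_cong)
  also have "\<dots> = complex_of_real (sqnorm d x)" by (simp add: ip_self[symmetric] ip_def)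
  finally show ?thesis by (simp only: of_real_eq_iff)
qed

text \<open>Cyclicity of the trace in coordinates: X_kl is paired with the (l, k) entry of \<Sum>
  D_b^* D_b, so trace preservation becomes a condition on that sum.\<close>

lemma mtrace_kraus:
  assumes D: "\<And>b. b \<in> I \<Longrightarrow> D b \<in> carrier_mat e d" and X: "X \<in> carrier_mat d d"
  shows "mtrace (msum e e I (\<lambda>b. D b * X * mat_adjoint (D b))) =
    (\<Sum>k<d. \<Sum>l<d. X $$ (k, l) * (\<Sum>b\<in>I. \<Sum>i<e. cnj (D b $$ (i, l)) * D b $$ (i, k)))"
proof -
  have "mtrace (msum e e I (\<lambda>b. D b * X * mat_adjoint (D b))) = (\<Sum>i<e. \<Sum>b\<in>I. \<Sum>k<d. \<Sum>l<d. D b $$ (i, k) * X $$ (k, l) * cnj (D b $$ (i, l)))"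
    by (simp add: mtrace_def msum_def sandwich_index[OF D X] del: index_mult_mat
        cong: sum.cong_simp)
  also have "\<dots> = (\<Sum>b\<in>I. \<Sum>i<e. \<Sum>k<d. \<Sum>l<d. D b $$ (i, k) * X $$ (k, l) * cnj (D b $$ (i, l)))"
    by (rule sum.swap)
  also have "\<dots> = (\<Sum>b\<in>I. \<Sum>k<d. \<Sum>i<e. \<Sum>l<d. D b $$ (i, k) * X $$ (k, l) * cnj (D b $$ (i, l)))"
    by (intro sum.cong refl sum.swap)
  also have "\<dots> = (\<Sum>k<d. \<Sum>b\<in>I. \<Sum>i<e. \<Sum>l<d. D b $$ (i, k) * X $$ (k, l) * cnj (D b $$ (i, l)))"
    by (rule sum.swap)
  also have "\<dots> = (\<Sum>k<d. \<Sum>b\<in>I. \<Sum>l<d. \<Sum>i<e. D b $$ (i, k) * X $$ (k, l) * cnj (D b $$ (i, l)))"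
    by (intro sum.cong refl sum.swap)
  also have "\<dots> = (\<Sum>k<d. \<Sum>l<d. \<Sum>b\<in>I. \<Sum>i<e. D b $$ (i, k) * X $$ (k, l) * cnj (D b $$ (i, l)))"
    by (intro sum.cong refl sum.swap)
  also have "\<dots> = (\<Sum>k<d. \<Sum>l<d. X $$ (k, l) * (\<Sum>b\<in>I. \<Sum>i<e. cnj (D b $$ (i, l)) * D b $$ (i, k)))"
    by (simp add: sum_distrib_left mult_ac)
  finally show ?thesis .
qed

lemma kraus_normalized_if_trace_preserving:
  assumes D: "\<And>b. b \<in> I \<Longrightarrow> D b \<in> carrier_mat e d"
    and tr: "\<And>X. X \<in> carrier_mat d d \<Longrightarrow>
      mtrace (msum e e I (\<lambda>b. D b * X * mat_adjoint (D b))) = mtrace X"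
  shows "kraus_normalized d e I D"
  unfolding kraus_normalized_def
proof (intro conjI ballI allI impI)
  fix k l assume kl: "k < d" "l < d"
  \<comment> \<open>The matrix unit has its 1 at (l, k), in transposed position, so that the trace
    formula returns the (k, l) entry of \<Sum> D_b^* D_b.\<close>
  define X :: "complex mat" where "X = mat d d (\<lambda>(p, q). if p = l then (if q = k then 1 else 0) else 0)"
  have X: "X \<in> carrier_mat d d" by (simp add: X_def)
  have "(\<Sum>p<d. \<Sum>q<d. X $$ (p, q) * (\<Sum>b\<in>I. \<Sum>i<e. cnj (D b $$ (i, q)) * D b $$ (i, p))) =
      (\<Sum>p<d. \<Sum>q<d. if p = l then (if q = k then
        (\<Sum>b\<in>I. \<Sum>i<e. cnj (D b $$ (i, k)) * D b $$ (i, l)) else 0) else 0)"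
    by (intro sum.cong refl) (simp add: X_def)
  also have "\<dots> = (\<Sum>p<d. if p = l then (\<Sum>b\<in>I. \<Sum>i<e. cnj (D b $$ (i, k)) * D b $$ (i, l)) else 0)"
    using kl by (intro sum.cong refl) simp
  also have "\<dots> = (\<Sum>b\<in>I. \<Sum>i<e. cnj (D b $$ (i, k)) * D b $$ (i, l))" using kl by simp
  finally have "mtrace X = (\<Sum>b\<in>I. \<Sum>i<e. cnj (D b $$ (i, k)) * D b $$ (i, l))"
    using tr[OF X] mtrace_kraus[of I D e d, OF D X] by simp
  moreover have "mtrace X = (\<Sum>p<d. if p = l then (if l = k then 1 else 0) else 0)"
    using X by (simp add: mtrace_def X_def cong: sum.cong_simp if_cong)
  then have "mtrace X = (if k = l then 1 else 0)" using kl by simp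
  ultimately show "(\<Sum>b\<in>I. \<Sum>i<e. cnj (D b $$ (i, k)) * D b $$ (i, l)) = (if k = l then 1 else 0)"
    by simp
qed (rule D)

text \<open>Complete positivity reduces to positivity of the input: the quadratic form of the output
  at v is the sum over b of the quadratic forms of X at z_b = (D_b^* \<otimes> 1) v.\<close>

theorem quantum_channel_kraus:
  assumes "kraus_normalized d e I D"
  shows "quantum_channel d e (\<lambda>X. msum e e I (\<lambda>b. D b * X * mat_adjoint (D b)))"
    (is "quantum_channel d e ?\<Phi>")
proof -
  have D: "\<And>b. b \<in> I \<Longrightarrow> D b \<in> carrier_mat e d"
    and norm: "\<And>k l. k < d \<Longrightarrow> l < d \<Longrightarrow>
      (\<Sum>b\<in>I. \<Sum>i<e. cnj (D b $$ (i, k)) * D b $$ (i, l)) = (if k = l then 1 else 0)"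
    using assms by (auto simp: kraus_normalized_def)
  have idx: "?\<Phi> X $$ (i, j) = (\<Sum>b\<in>I. \<Sum>k<d. \<Sum>l<d. D b $$ (i, k) * X $$ (k, l) * cnj (D b $$ (j, l)))"
    if "X \<in> carrier_mat d d" "i < e" "j < e" for X i j
    using that by (simp add: msum_def sandwich_index[OF D that] del: index_mult_mat cong: sum.cong)
  have car: "?\<Phi> X \<in> carrier_mat e e" for X by (simp add: msum_def)
  have "linear_superop d e ?\<Phi>"
    unfolding linear_superop_def
  proof (intro conjI ballI allI)
    fix X Y :: "complex mat" assume X: "X \<in> carrier_mat d d" and Y: "Y \<in> carrier_mat d d"
    show "?\<Phi> (X + Y) = ?\<Phi> X + ?\<Phi> Y"
    proof (rule eq_matI)
      fix i j assume "i < dim_row (?\<Phi> X + ?\<Phi> Y)" "j < dim_col (?\<Phi> X + ?\<Phi> Y)"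
      then have ij: "i < e" "j < e" by (auto simp: msum_def)
      have "X + Y \<in> carrier_mat d d" using X Y by simp
      moreover have "(X + Y) $$ (k, l) = X $$ (k, l) + Y $$ (k, l)" if "k < d" "l < d" for k l
        using X Y that by simp
      moreover have "(?\<Phi> X + ?\<Phi> Y) $$ (i, j) = ?\<Phi> X $$ (i, j) + ?\<Phi> Y $$ (i, j)"
        using ij car by (intro index_add_mat) (auto simp: msum_def)
      ultimately show "?\<Phi> (X + Y) $$ (i, j) = (?\<Phi> X + ?\<Phi> Y) $$ (i, j)"
        using X Y ij by (simp add: idx distrib_left distrib_right sum.distrib del: index_add_mat)
    qed (auto simp: msum_def)
  next
    fix X :: "complex mat" and c assume X: "X \<in> carrier_mat d d"
    show "?\<Phi> (c \<cdot>\<^sub>m X) = c \<cdot>\<^sub>m ?\<Phi> X"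
    proof (rule eq_matI)
      fix i j assume "i < dim_row (c \<cdot>\<^sub>m ?\<Phi> X)" "j < dim_col (c \<cdot>\<^sub>m ?\<Phi> X)"
      then have ij: "i < e" "j < e" by (auto simp: msum_def)
      have "c \<cdot>\<^sub>m X \<in> carrier_mat d d" using X by simp
      moreover have "(c \<cdot>\<^sub>m X) $$ (k, l) = c * X $$ (k, l)" if "k < d" "l < d" for k l
        using X that by simp
      moreover have "(c \<cdot>\<^sub>m ?\<Phi> X) $$ (i, j) = c * ?\<Phi> X $$ (i, j)"
        using ij by (intro index_smult_mat) (auto simp: msum_def)
      ultimately show "?\<Phi> (c \<cdot>\<^sub>m X) $$ (i, j) = (c \<cdot>\<^sub>m ?\<Phi> X) $$ (i, j)"
        using X ij by (simp add: idx sum_distrib_left mult_ac del: index_smult_mat)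
    qed (auto simp: msum_def)
  qed (rule car)
  moreover have "mtrace (?\<Phi> X) = mtrace X" if X: "X \<in> carrier_mat d d" for X
  proof -
    have "mtrace (?\<Phi> X) =
        (\<Sum>k<d. \<Sum>l<d. X $$ (k, l) * (\<Sum>b\<in>I. \<Sum>i<e. cnj (D b $$ (i, l)) * D b $$ (i, k)))"
      by (rule mtrace_kraus[OF D X])
    also have "\<dots> = (\<Sum>k<d. \<Sum>l<d. if l = k then X $$ (k, k) else 0)"
      by (intro sum.cong refl) (simp add: norm)
    also have "\<dots> = mtrace X" using X by (simp add: mtrace_def)
    finally show ?thesis .
  qed
  moreover have "psd (e * r) (tensor_id r d e ?\<Phi> X)" if psd: "psd (d * r) X" for r X
  proof -
    have X: "X \<in> carrier_mat (d * r) (d * r)" and pos: "\<And>v. v \<in> carrier_vec (d * r) \<Longrightarrow> 0 \<le> (X *\<^sub>v v) \<bullet>c v"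
      using psd by (auto simp: psd_def)
    have quad: "(A *\<^sub>v v) \<bullet>c v = (\<Sum>i<n. \<Sum>j<n. cnj (v $ i) * A $$ (i, j) * v $ j)"
      if "A \<in> carrier_mat n n" "v \<in> carrier_vec n" for A :: "complex mat" and v n
      using that by (auto simp: scalar_prod_def atLeast0LessThan sum_distrib_left sum_distrib_right mult_ac
          intro!: sum.cong)
    define Y where "Y = tensor_id r d e ?\<Phi> X"
    have Y: "Y \<in> carrier_mat (e * r) (e * r)" by (simp add: Y_def tensor_id_def)
    have "0 \<le> (Y *\<^sub>v v) \<bullet>c v" if v: "v \<in> carrier_vec (e * r)" for v
    proof -
      define z where "z b = vec (d * r) (\<lambda>p. \<Sum>i<e. cnj (D b $$ (i, p div r)) * v $ (i * r + p mod r))" for b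
      have zc: "z b \<in> carrier_vec (d * r)" for b by (simp add: z_def)
      have Yi: "Y $$ (i * r + a, j * r + a') = (\<Sum>b\<in>I. \<Sum>k<d. \<Sum>l<d.
          D b $$ (i, k) * X $$ (k * r + a, l * r + a') * cnj (D b $$ (j, l)))"
        if "i < e" "j < e" "a < r" "a' < r" for i j a a'
        using that by (simp add: Y_def tensor_id_def mult_add_less_mult idx)
      have "(Y *\<^sub>v v) \<bullet>c v = (\<Sum>i<e. \<Sum>a<r. \<Sum>j<e. \<Sum>a'<r. \<Sum>b\<in>I. \<Sum>k<d. \<Sum>l<d.
          cnj (v $ (i * r + a)) * (D b $$ (i, k) * X $$ (k * r + a, l * r + a') * cnj (D b $$ (j, l))) *
          v $ (j * r + a'))"
        unfolding quad[OF Y v] sum_lessThan_mult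
        by (intro sum.cong refl) (simp add: Yi sum_distrib_left sum_distrib_right)
      also have "\<dots> = (\<Sum>b\<in>I. \<Sum>k<d. \<Sum>a<r. \<Sum>l<d. \<Sum>a'<r. \<Sum>i<e. \<Sum>j<e.
          cnj (v $ (i * r + a)) * (D b $$ (i, k) * X $$ (k * r + a, l * r + a') * cnj (D b $$ (j, l))) *
          v $ (j * r + a'))"
        \<comment> \<open>A bijection of index tuples interchanges all seven sums at once and brings
          those over i and j inside, where they form the entries of z_b and their
          conjugates.\<close>
        unfolding sum.cartesian_product
        by (rule sum.reindex_bij_witness[where
              i = "\<lambda>(b, k, a, l, a', i, j). (i, a, j, a', b, k, l)" and
              j = "\<lambda>(i, a, j, a', b, k, l). (b, k, a, l, a', i, j)"]) auto
      also have "\<dots> = (\<Sum>b\<in>I. \<Sum>k<d. \<Sum>a<r. \<Sum>l<d. \<Sum>a'<r.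
          cnj (z b $ (k * r + a)) * X $$ (k * r + a, l * r + a') * z b $ (l * r + a'))"
        by (intro sum.cong refl)
          (simp add: z_def mult_add_less_mult sum_distrib_left sum_distrib_right mult_ac)
      also have "\<dots> = (\<Sum>b\<in>I. (X *\<^sub>v z b) \<bullet>c z b)"
        unfolding quad[OF X zc] sum_lessThan_mult ..
      also have "0 \<le> \<dots>" by (intro sum_nonneg pos zc)
      finally show ?thesis .
    qed
    then show ?thesis using Y by (simp add: psd_def Y_def)
  qed
  ultimately show ?thesis by (simp add: quantum_channel_def)
qed

subsection \<open>The decoder\<close>

lemma mapply_mult:
  assumes "A \<in> carrier_mat n k" "B \<in> carrier_mat k l" "i < n"
  shows "mapply (A * B) x i = mapply A (mapply B x) i"
proof -
  have "mapply (A * B) x i = (\<Sum>j<l. \<Sum>p<k. A $$ (i, p) * B $$ (p, j) * x j)"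
    using assms by (simp add: mapply_def mult_mat_index[OF assms(1,2)] sum_distrib_right
        del: index_mult_mat(1))
  also have "\<dots> = (\<Sum>p<k. \<Sum>j<l. A $$ (i, p) * B $$ (p, j) * x j)" by (rule sum.swap)
  also have "\<dots> = mapply A (mapply B x) i"
    using assms by (simp add: mapply_def sum_distrib_left mult.assoc)
  finally show ?thesis .
qed

lemma mapply_cong: "(\<And>k. k < dim_col A \<Longrightarrow> x k = y k) \<Longrightarrow> mapply A x i = mapply A y i"
  by (simp add: mapply_def)

lemma mapply_diff: "mapply A (\<lambda>k. x k - y k) i = mapply A x i - mapply A y i"
  by (simp add: mapply_def right_diff_distrib sum_subtractf)

lemma mapply_one: "i < n \<Longrightarrow> mapply (1\<^sub>m n) x i = x i"
proof -
  assume "i < n"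
  then have "mapply (1\<^sub>m n) x i = (\<Sum>k<n. if k = i then x i else 0)"
    unfolding mapply_def by (intro sum.cong) auto
  then show ?thesis using \<open>i < n\<close> by simp
qed

lemma sqnorm_cong: "(\<And>k. k < n \<Longrightarrow> x k = y k) \<Longrightarrow> sqnorm n x = sqnorm n y"
  by (simp add: sqnorm_def)

lemma sqnorm_scale: "sqnorm n (\<lambda>k. c * x k) = (cmod c)\<^sup>2 * sqnorm n x"
  by (simp add: sqnorm_def norm_mult power_mult_distrib sum_distrib_left)

lemma isometry_sqnorm:
  assumes "isometry k n V"
  shows "sqnorm n (mapply V x) = sqnorm k x"
proof -
  have V: "V \<in> carrier_mat n k" and VV: "mat_adjoint V * V = 1\<^sub>m k"
    using assms by (auto simp: isometry_def)
  \<comment> \<open>An isometry is a normalized Kraus family with one member.\<close>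
  have "kraus_normalized k n {()} (\<lambda>_. V)"
    using V by (auto simp: kraus_normalized_def adjoint_mult_index[OF V V, symmetric] VV)
  from kraus_normalized_sqnorm[OF this, of x] show ?thesis by simp
qed

text \<open>The isometry is the unitary factor in the polar decomposition of \<open>T\<close>.\<close>

lemma approx_isometry_ex_isometry:
  assumes T: "approx_isometry \<delta> n l T" and \<delta>: "\<delta> < 1"
  shows "\<exists>W. isometry l n W \<and>
    (\<forall>x. sqnorm n (\<lambda>i. mapply T x i - mapply W x i) \<le> \<delta>\<^sup>2 * sqnorm l x)"
proof -
  have Tc: "T \<in> carrier_mat n l" using T by (simp add: approx_isometry_def)
  obtain Q s where Q: "unitary l Q" and s0: "\<And>j. 0 \<le> s j"
    and gram: "mat_adjoint (T * Q) * (T * Q) = mat_diag l (\<lambda>j. complex_of_real ((s j)\<^sup>2))"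
    and sv: "singular_values T = image_mset s (mset_set {..<l})"
    using gram_diagonalization[OF Tc] by blast
  have s: "1 - \<delta> \<le> s j" "s j \<le> 1 + \<delta>" if "j < l" for j
  proof -
    have "s_min T \<le> s j" "s j \<le> s_max T"
      using that by (auto simp: s_min_def s_max_def sv intro!: Min_le Max_ge)
    then show "1 - \<delta> \<le> s j" "s j \<le> 1 + \<delta>" using T by (auto simp: approx_isometry_def)
  qed
  \<comment> \<open>Here \<delta> < 1 enters: every column of \<open>T * Q\<close> can be
    normalized.\<close>
  have spos: "s j > 0" if "j < l" for j using s(1)[OF that] \<delta> by simp
  have Qc: "Q \<in> carrier_mat l l" and QQ: "mat_adjoint Q * Q = 1\<^sub>m l" "Q * mat_adjoint Q = 1\<^sub>m l"
    using Q by (auto simp: unitary_def)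
  have aQ: "mat_adjoint Q \<in> carrier_mat l l" using Qc by simp
  define B where "B = T * Q"
  have B: "B \<in> carrier_mat n l" using Tc Qc by (simp add: B_def)
  define A where "A = mat n l (\<lambda>(i, j). B $$ (i, j) / complex_of_real (s j))"
  have A: "A \<in> carrier_mat n l" by (simp add: A_def)
  \<comment> \<open>With S the diagonal matrix of singular values, T = A S Q^-1 = W P for the
    positive matrix P = Q S Q^-1.\<close>
  define W where "W = A * mat_adjoint Q"
  have W: "W \<in> carrier_mat n l" using A Qc by (simp add: W_def)
  have ipB: "ip n (\<lambda>p. B $$ (p, i)) (\<lambda>p. B $$ (p, j)) = (if i = j then complex_of_real ((s j)\<^sup>2) else 0)"
    if "i < l" "j < l" for i j
    unfolding ip_def adjoint_mult_index[OF B B that, symmetric]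
    using that by (simp add: B_def gram mat_diag_def)
  have "mat_adjoint A * A = 1\<^sub>m l"
  proof (rule eq_matI)
    fix i j assume "i < dim_row (1\<^sub>m l :: complex mat)" "j < dim_col (1\<^sub>m l :: complex mat)"
    then have ij: "i < l" "j < l" by auto
    have "(mat_adjoint A * A) $$ (i, j) =
        ip n (\<lambda>p. B $$ (p, i)) (\<lambda>p. B $$ (p, j)) / complex_of_real (s i * s j)"
      using ij unfolding adjoint_mult_index[OF A A ij] ip_def
      by (simp add: A_def sum_divide_distrib)
    then show "(mat_adjoint A * A) $$ (i, j) = 1\<^sub>m l $$ (i, j)"
      using ij spos[of i] spos[of j] by (auto simp: ipB power2_eq_square)
  qed (use A in auto)
  moreover have "mat_adjoint W * W = Q * (mat_adjoint A * A) * mat_adjoint Q"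
  proof -
    have aA: "mat_adjoint A \<in> carrier_mat l n" using A by simp
    have "mat_adjoint W * W = Q * mat_adjoint A * (A * mat_adjoint Q)"
      using A aQ by (simp add: W_def adjoint_mult)
    also have "\<dots> = Q * mat_adjoint A * A * mat_adjoint Q"
      using assoc_mult_mat[OF mult_carrier_mat[OF Qc aA] A aQ] by simp
    also have "Q * mat_adjoint A * A = Q * (mat_adjoint A * A)"
      using assoc_mult_mat[OF Qc aA A] .
    finally show ?thesis .
  qed
  ultimately have "isometry l n W" using W QQ Qc by (simp add: isometry_def)
  moreover have "sqnorm n (\<lambda>i. mapply T x i - mapply W x i) \<le> \<delta>\<^sup>2 * sqnorm l x" for x
  proof -
    define z where "z = mapply (mat_adjoint Q) x"
    have zip: "z j = ip l (\<lambda>p. Q $$ (p, j)) x" if "j < l" for j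
      using that Qc by (simp add: z_def mapply_def ip_def)
    have "T = B * mat_adjoint Q"
      using assoc_mult_mat[OF Tc Qc aQ] Tc by (simp add: B_def QQ)
    then have Tx: "mapply T x i = (\<Sum>j<l. z j * B $$ (i, j))" if "i < n" for i
      using mapply_mult[OF B aQ that] B by (simp add: z_def mapply_def mult.commute)
    have Wx: "mapply W x i = (\<Sum>j<l. z j / complex_of_real (s j) * B $$ (i, j))" if "i < n" for i
      using mapply_mult[OF A aQ that, of x] A that
      by (simp add: W_def z_def[symmetric]) (simp add: mapply_def A_def mult.commute)
    have "sqnorm n (\<lambda>i. mapply T x i - mapply W x i) =
        sqnorm n (\<lambda>i. \<Sum>j<l. (z j - z j / complex_of_real (s j)) * B $$ (i, j))"
      by (intro sqnorm_cong) (simp add: Tx Wx sum_subtractf[symmetric] left_diff_distrib)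
    also have "\<dots> = (\<Sum>j<l. (cmod (z j - z j / complex_of_real (s j)))\<^sup>2 * sqnorm n (\<lambda>i. B $$ (i, j)))"
      by (rule sqnorm_orthogonal_sum) (simp add: ipB)
    \<comment> \<open>The coefficient is z_j times 1 - 1 / s_j and the column it multiplies has
      length s_j, which together give |s_j - 1| |z_j|.\<close>
    also have "\<dots> = (\<Sum>j<l. (s j - 1)\<^sup>2 * (cmod (z j))\<^sup>2)"
    proof (intro sum.cong refl)
      fix j assume "j \<in> {..<l}"
      then have j: "j < l" by simp
      have "complex_of_real (sqnorm n (\<lambda>i. B $$ (i, j))) = complex_of_real ((s j)\<^sup>2)"
        using ipB[OF j j] by (simp add: ip_self)
      then have "sqnorm n (\<lambda>i. B $$ (i, j)) = (s j)\<^sup>2" by (simp only: of_real_eq_iff)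
      moreover have "z j - z j / complex_of_real (s j) = complex_of_real ((s j - 1) / s j) * z j"
        using spos[OF j] by (simp add: field_simps)
      ultimately show "(cmod (z j - z j / complex_of_real (s j)))\<^sup>2 * sqnorm n (\<lambda>i. B $$ (i, j)) =
          (s j - 1)\<^sup>2 * (cmod (z j))\<^sup>2"
        using spos[OF j] by (simp only: norm_mult norm_of_real power_mult_distrib power2_abs)
          (simp add: field_simps)
    qed
    also have "\<dots> \<le> (\<Sum>j<l. \<delta>\<^sup>2 * (cmod (z j))\<^sup>2)"
    proof (intro sum_mono mult_right_mono)
      fix j assume "j \<in> {..<l}"
      then have "\<bar>s j - 1\<bar> \<le> \<bar>\<delta>\<bar>" using s[of j] by auto
      then show "(s j - 1)\<^sup>2 \<le> \<delta>\<^sup>2" by (rule abs_le_square_iff[THEN iffD1])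
    qed simp
    also have "\<dots> = \<delta>\<^sup>2 * (\<Sum>j<l. (cmod (ip l (\<lambda>p. Q $$ (p, j)) x))\<^sup>2)"
      by (simp add: sum_distrib_left zip)
    \<comment> \<open>The z_j are the coordinates of x with respect to the orthonormal columns of
      \<open>Q\<close>.\<close>
    also have "\<dots> \<le> \<delta>\<^sup>2 * sqnorm l x"
    proof (intro mult_left_mono bessel)
      have qip: "ip l (\<lambda>p. Q $$ (p, i)) (\<lambda>p. Q $$ (p, j)) = (if i = j then 1 else 0)"
        if "i < l" "j < l" for i j
        unfolding ip_def adjoint_mult_index[OF Qc Qc that, symmetric] QQ using that by simp
      have "sqnorm l (\<lambda>p. Q $$ (p, i)) = 1" if "i < l" for i
        using qip[OF that that] by (simp add: ip_self)
      then show "subnormal_family l l (\<lambda>j p. Q $$ (p, j))"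
        using qip by (simp add: subnormal_family_def)
    qed simp
    finally show ?thesis .
  qed
  ultimately show ?thesis by blast
qed

text \<open>Kraus operators of the decoder that undoes the isometry \<open>W\<close> and traces out
  $\mathbf{C}^m$. The summands \<open>Inr j\<close> send the complement of the range of \<open>W\<close> to the first basis
  vector, which makes the map trace preserving.\<close>

definition decoder_kraus :: "nat \<Rightarrow> nat \<Rightarrow> nat \<Rightarrow> complex mat \<Rightarrow> nat + nat \<Rightarrow> complex mat" where
  "decoder_kraus n k m W = case_sum
     (\<lambda>b. mat k n (\<lambda>(i, r). mat_adjoint W $$ (i * m + b, r)))
     (\<lambda>j. mat k n (\<lambda>(i, r). if i = 0 then (1\<^sub>m n - W * mat_adjoint W) $$ (j, r) else 0))"

lemma decoder_kraus_carrier [simp]: "decoder_kraus n k m W b \<in> carrier_mat k n"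
  by (simp add: decoder_kraus_def split: sum.split)

text \<open>In \<Sum> D_b^* D_b the \<open>Inl\<close> operators contribute the projection P onto
  the range of W, and the \<open>Inr\<close> operators contribute R^* R = R for R = 1 - P.
  Positivity of \<open>k\<close> provides the basis vector that receives the complement.\<close>

lemma decoder_kraus_normalized:
  assumes W: "isometry (k * m) n W" and k: "0 < k"
  shows "kraus_normalized n k ({..<m} <+> {..<n}) (decoder_kraus n k m W)"
  unfolding kraus_normalized_def
proof (intro conjI ballI allI impI)
  have Wc: "W \<in> carrier_mat n (k * m)" and WW: "mat_adjoint W * W = 1\<^sub>m (k * m)"
    using W by (auto simp: isometry_def)
  have aW: "mat_adjoint W \<in> carrier_mat (k * m) n" using Wc by simp
  define P where "P = W * mat_adjoint W"
  have P: "P \<in> carrier_mat n n" using Wc aW by (simp add: P_def)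
  have "P * P = W * (mat_adjoint W * W) * mat_adjoint W"
    using assoc_mult_mat[OF Wc aW P] assoc_mult_mat[OF aW Wc aW] assoc_mult_mat[OF Wc _ aW, of "mat_adjoint W * W"]
      mult_carrier_mat[OF aW Wc] by (simp add: P_def)
  then have PP: "P * P = P" using Wc by (simp add: WW P_def)
  have aP: "mat_adjoint P = P" using adjoint_mult[OF Wc aW] by (simp add: P_def)
  define R where "R = 1\<^sub>m n - P"
  have R: "R \<in> carrier_mat n n" using P by (simp add: R_def minus_carrier_mat)
  have "mat_adjoint R = R"
  proof (rule eq_matI)
    fix i j assume ij: "i < dim_row R" "j < dim_col R"
    then have "cnj (P $$ (j, i)) = P $$ (i, j)"
      using P R by (subst (2) aP[symmetric], subst adjoint_index) auto
    then show "mat_adjoint R $$ (i, j) = R $$ (i, j)" using ij P R by (auto simp: R_def)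
  qed (use R in auto)
  moreover have "R * R = R"
  proof -
    have "R * R = R - P * R"
      unfolding R_def using P minus_mult_distrib_mat[of "1\<^sub>m n" n n P "1\<^sub>m n - P" n] by (simp add: minus_carrier_mat)
    also have "P * R = P - P * P"
      unfolding R_def using P mult_minus_distrib_mat[of P n n "1\<^sub>m n" n P] by simp
    also have "\<dots> = 0\<^sub>m n n" using P by (simp add: PP)
    finally show ?thesis using R by auto
  qed
  ultimately have RR: "mat_adjoint R * R = R" by simp
  fix p q assume pq: "p < n" "q < n"
  let ?D = "decoder_kraus n k m W"
  have "(\<Sum>b\<in>{..<m} <+> {..<n}. \<Sum>i<k. cnj (?D b $$ (i, p)) * ?D b $$ (i, q)) =
      (\<Sum>b<m. \<Sum>i<k. W $$ (p, i * m + b) * cnj (W $$ (q, i * m + b))) +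
      (\<Sum>j<n. \<Sum>i<k. if i = 0 then cnj (R $$ (j, p)) * R $$ (j, q) else 0)"
    unfolding sum.Plus[OF finite_lessThan finite_lessThan] o_def
    by (intro arg_cong2[where f = "(+)"] sum.cong refl)
      (use pq Wc in \<open>auto simp: decoder_kraus_def mult_add_less_mult R_def P_def\<close>)
  also have "(\<Sum>b<m. \<Sum>i<k. W $$ (p, i * m + b) * cnj (W $$ (q, i * m + b))) =
      (\<Sum>i<k * m. W $$ (p, i) * cnj (W $$ (q, i)))"
    unfolding sum_lessThan_mult by (rule sum.swap)
  also have "\<dots> = P $$ (p, q)"
    unfolding P_def mult_mat_index[OF Wc aW pq] using pq Wc by (intro sum.cong) auto
  also have "(\<Sum>j<n. \<Sum>i<k. if i = 0 then cnj (R $$ (j, p)) * R $$ (j, q) else 0) = R $$ (p, q)"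
    using k adjoint_mult_index[OF R R pq] by (simp add: RR)
  also have "P $$ (p, q) + R $$ (p, q) = (if p = q then 1 else 0)"
    using pq P by (simp add: R_def)
  finally show "(\<Sum>b\<in>{..<m} <+> {..<n}. \<Sum>i<k. cnj (?D b $$ (i, p)) * ?D b $$ (i, q)) =
      (if p = q then 1 else 0)" .
qed simp

text \<open>Since W^* W = 1, composing with W turns the operator \<open>Inl b\<close> into the slice
  selector 1 \<otimes> <b|, while R W = 0 for the complementary projection R removes the
  \<open>Inr\<close> operators.\<close>

lemma mapply_decoder_kraus:
  assumes W: "isometry (k * m) n W" and b: "b \<in> {..<m} <+> {..<n}" and i: "i < k"
  shows "mapply (decoder_kraus n k m W b) (mapply W y) i =
    (case b of Inl b \<Rightarrow> y (i * m + b) | Inr _ \<Rightarrow> 0)"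
proof -
  have Wc: "W \<in> carrier_mat n (k * m)" and WW: "mat_adjoint W * W = 1\<^sub>m (k * m)"
    using W by (auto simp: isometry_def)
  have aW: "mat_adjoint W \<in> carrier_mat (k * m) n" using Wc by simp
  show ?thesis
  proof (cases b)
    case (Inl c)
    then have c: "c < m" using b by auto
    have "mapply (decoder_kraus n k m W b) (mapply W y) i = mapply (mat_adjoint W) (mapply W y) (i * m + c)"
      using i Wc by (simp add: Inl decoder_kraus_def mapply_def)
    also have "\<dots> = mapply (mat_adjoint W * W) y (i * m + c)"
      using mapply_mult[OF aW Wc] mult_add_less_mult[OF i c] by simp
    finally show ?thesis using mult_add_less_mult[OF i c] by (simp add: WW mapply_one Inl)
  next
    case (Inr j)
    then have j: "j < n" using b by auto
    define R where "R = 1\<^sub>m n - W * mat_adjoint W"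
    have R: "R \<in> carrier_mat n n" using mult_carrier_mat[OF Wc aW] by (simp add: R_def minus_carrier_mat)
    have "R * W = W - W * (mat_adjoint W * W)"
      unfolding R_def using minus_mult_distrib_mat[of "1\<^sub>m n" n n "W * mat_adjoint W" W "k * m"]
        assoc_mult_mat[OF Wc aW Wc] mult_carrier_mat[OF Wc aW] Wc by simp
    then have RW: "R * W = 0\<^sub>m n (k * m)" using Wc by (simp add: WW)
    have "mapply (decoder_kraus n k m W b) (mapply W y) i = (if i = 0 then mapply R (mapply W y) j else 0)"
      using i R by (simp add: Inr decoder_kraus_def mapply_def R_def[symmetric])
    also have "mapply R (mapply W y) j = mapply (R * W) y j"
      using mapply_mult[OF R Wc j] by simp
    finally show ?thesis using j by (simp add: RW mapply_def Inr)
  qed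
qed

section \<open>Composition of Kraus maps and noise in the span of the errors\<close>

lemma sandwich_mult:
  fixes A B X :: "complex mat"
  assumes A: "A \<in> carrier_mat n k" and B: "B \<in> carrier_mat k l" and X: "X \<in> carrier_mat l l"
  shows "A * (B * X * mat_adjoint B) * mat_adjoint A = A * B * X * mat_adjoint (A * B)"
proof -
  have aA: "mat_adjoint A \<in> carrier_mat k n" and aB: "mat_adjoint B \<in> carrier_mat l k"
    and BX: "B * X \<in> carrier_mat k l" and AB: "A * B \<in> carrier_mat n l"
    using A B X by auto
  have ABX: "A * B * X \<in> carrier_mat n l" using AB X by simp
  show ?thesis
    using assoc_mult_mat[OF A BX aB] assoc_mult_mat[OF A B X] assoc_mult_mat[OF ABX aB aA]
      adjoint_mult[OF A B] by simp
qed

lemma sandwich_msum_index: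
  assumes A: "A \<in> carrier_mat n k" and F: "\<And>a. a \<in> I \<Longrightarrow> F a \<in> carrier_mat k k" and ij: "i < n" "j < n"
  shows "(A * msum k k I F * mat_adjoint A) $$ (i, j) = (\<Sum>a\<in>I. (A * F a * mat_adjoint A) $$ (i, j))"
proof -
  have "(A * msum k k I F * mat_adjoint A) $$ (i, j) =
      (\<Sum>p<k. \<Sum>q<k. \<Sum>a\<in>I. A $$ (i, p) * F a $$ (p, q) * cnj (A $$ (j, q)))"
    by (subst sandwich_index[OF A _ ij])
      (auto simp: msum_def sum_distrib_left sum_distrib_right intro!: sum.cong)
  also have "\<dots> = (\<Sum>p<k. \<Sum>a\<in>I. \<Sum>q<k. A $$ (i, p) * F a $$ (p, q) * cnj (A $$ (j, q)))"
    by (intro sum.cong refl sum.swap)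
  also have "\<dots> = (\<Sum>a\<in>I. \<Sum>p<k. \<Sum>q<k. A $$ (i, p) * F a $$ (p, q) * cnj (A $$ (j, q)))"
    by (rule sum.swap)
  also have "\<dots> = (\<Sum>a\<in>I. (A * F a * mat_adjoint A) $$ (i, j))"
    by (intro sum.cong refl sandwich_index[OF A F ij, symmetric])
  finally show ?thesis .
qed

text \<open>Taking the trace of $\sum_a K_a^* K_a = I$ shows that the coefficient vectors of the Kraus
  operators have total squared norm 1, as the errors are orthogonal with $\mathrm{tr}(E_i^* E_i) = N$.\<close>

lemma Channels_error_span_kraus:
  assumes n: "0 < n" and E: "unitary_error_set n m E" and N: "\<N> \<in> Channels n (error_span n m E)"
  shows "\<exists>L c. kraus_normalized n n {..<L::nat} (\<lambda>a. msum n n {..<m} (\<lambda>i. c a i \<cdot>\<^sub>m E i)) \<and>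
    (\<forall>\<rho>\<in>carrier_mat n n. \<N> \<rho> = msum n n {..<L} (\<lambda>a. msum n n {..<m} (\<lambda>i. c a i \<cdot>\<^sub>m E i) * \<rho> *
      mat_adjoint (msum n n {..<m} (\<lambda>i. c a i \<cdot>\<^sub>m E i)))) \<and>
    (\<Sum>a<L. sqnorm m (c a)) = 1"
proof -
  obtain Ks where qc: "quantum_channel n n \<N>" and Ks: "set Ks \<subseteq> error_span n m E"
    and N_eq: "\<And>\<rho>. \<rho> \<in> carrier_mat n n \<Longrightarrow>
      \<N> \<rho> = msum n n {..<length Ks} (\<lambda>a. Ks ! a * \<rho> * mat_adjoint (Ks ! a))"
    using N by (auto simp: Channels_def)
  define L where "L = length Ks"
  have "\<forall>a<L. \<exists>c. Ks ! a = msum n n {..<m} (\<lambda>i. c i \<cdot>\<^sub>m E i)"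
    using Ks nth_mem by (fastforce simp: error_span_def L_def)
  then obtain c where c: "\<And>a. a < L \<Longrightarrow> Ks ! a = msum n n {..<m} (\<lambda>i. c a i \<cdot>\<^sub>m E i)" by metis
  define D where "D a = msum n n {..<m} (\<lambda>i. c a i \<cdot>\<^sub>m E i)" for a
  have D: "D a \<in> carrier_mat n n" for a by (simp add: D_def msum_def)
  have Ec: "E i \<in> carrier_mat n n" and EE: "mat_adjoint (E i) * E i = 1\<^sub>m n" if "i < m" for i
    using E that by (auto simp: unitary_error_set_def unitary_def)
  have N_eq': "\<N> \<rho> = msum n n {..<L} (\<lambda>a. D a * \<rho> * mat_adjoint (D a))" if "\<rho> \<in> carrier_mat n n" for \<rho>
  proof -
    have "Ks ! a = D a" if "a < L" for a using c[OF that] by (simp add: D_def)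
    then show ?thesis
      unfolding N_eq[OF that] L_def[symmetric] msum_def by (simp cong: sum.cong_simp)
  qed
  have norm: "kraus_normalized n n {..<L} D"
    using qc N_eq' by (intro kraus_normalized_if_trace_preserving D) (auto simp: quantum_channel_def)
  have trE: "(\<Sum>k<n. \<Sum>i<n. cnj (E p $$ (i, k)) * E q $$ (i, k)) = (if p = q then of_nat n else 0)"
    if pq: "p < m" "q < m" for p q
  proof -
    have "mtrace (mat_adjoint (E p) * E q) = (\<Sum>k<n. \<Sum>i<n. cnj (E p $$ (i, k)) * E q $$ (i, k))"
      using Ec[OF pq(1)] Ec[OF pq(2)] unfolding mtrace_def
      by (intro sum.cong) (auto simp: adjoint_mult_index[OF Ec[OF pq(1)] Ec[OF pq(2)]] simp del: index_mult_mat(1))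
    moreover have "mtrace (mat_adjoint (E p) * E q) = (if p = q then of_nat n else 0)"
    proof (cases "p = q")
      case True
      then show ?thesis using EE[OF pq(2)] by (simp only: True) (simp add: mtrace_def)
    next
      case False
      then show ?thesis using E pq by (simp add: unitary_error_set_def)
    qed
    ultimately show ?thesis by simp
  qed
  \<comment> \<open>The squared Hilbert-Schmidt norm of one Kraus operator, expanded in the
    orthogonal errors.\<close>
  have one: "(\<Sum>k<n. \<Sum>i<n. cnj (D a $$ (i, k)) * D a $$ (i, k)) = of_nat n * complex_of_real (sqnorm m (c a))" for a
  proof -
    have Di: "D a $$ (i, k) = (\<Sum>p<m. c a p * E p $$ (i, k))" if "i < n" "k < n" for i k
      using that carrier_matD[OF Ec] by (simp add: D_def msum_def cong: sum.cong_simp)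
    have "(\<Sum>k<n. \<Sum>i<n. cnj (D a $$ (i, k)) * D a $$ (i, k)) =
        (\<Sum>k<n. \<Sum>i<n. \<Sum>p<m. \<Sum>q<m. cnj (c a p) * c a q * (cnj (E p $$ (i, k)) * E q $$ (i, k)))"
      by (intro sum.cong refl) (simp only: lessThan_iff Di cnj_sum sum_product, simp add: mult_ac)
    also have "\<dots> = (\<Sum>p<m. \<Sum>q<m. \<Sum>k<n. \<Sum>i<n. cnj (c a p) * c a q * (cnj (E p $$ (i, k)) * E q $$ (i, k)))"
      unfolding sum.cartesian_product
      by (rule sum.reindex_bij_witness[where i = "\<lambda>(p, q, k, i). (k, i, p, q)" and
            j = "\<lambda>(k, i, p, q). (p, q, k, i)"]) auto
    also have "\<dots> = (\<Sum>p<m. \<Sum>q<m. cnj (c a p) * c a q * (if p = q then of_nat n else 0))"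
      by (intro sum.cong refl) (simp add: sum_distrib_left[symmetric] trE)
    also have "\<dots> = (\<Sum>p<m. cnj (c a p) * c a p * of_nat n)" by (simp add: if_distrib cong: if_cong)
    also have "\<dots> = of_nat n * ip m (c a) (c a)" by (simp add: ip_def sum_distrib_left mult_ac)
    finally show ?thesis by (simp add: ip_self)
  qed
  \<comment> \<open>The n diagonal entries of the normalization condition add up to the trace of the
    identity.\<close>
  have "(\<Sum>k<n. \<Sum>a<L. \<Sum>i<n. cnj (D a $$ (i, k)) * D a $$ (i, k)) = of_nat n"
    using norm by (simp add: kraus_normalized_def cong: sum.cong_simp)
  moreover have "(\<Sum>k<n. \<Sum>a<L. \<Sum>i<n. cnj (D a $$ (i, k)) * D a $$ (i, k)) =
      (\<Sum>a<L. of_nat n * complex_of_real (sqnorm m (c a)))"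
    unfolding one[symmetric] by (rule sum.swap)
  ultimately have "of_nat n * complex_of_real (\<Sum>a<L. sqnorm m (c a)) = of_nat n"
    by (simp add: sum_distrib_left)
  then have "complex_of_real (\<Sum>a<L. sqnorm m (c a)) = 1" using n by (simp del: of_real_sum)
  then have "(\<Sum>a<L. sqnorm m (c a)) = 1" by (simp only: of_real_eq_1_iff)
  with norm N_eq' show ?thesis unfolding D_def by blast
qed

theorem theorem1p10:
  fixes N K m :: nat and V :: "complex mat" and E :: "nat \<Rightarrow> complex mat" and \<delta> :: real
  assumes "0 < N" and "0 < K" and "0 < m"
    and "isometry K N V"
    and "unitary_error_set N m E"
    and "0 \<le> \<delta>" and "\<delta> < 1"
    and "approx_nondegenerate_code \<delta> N K m E V"
  shows "corrects_with_disturbance N K V (error_span N m E) \<delta>"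
proof -
  note N = assms(1) and K = assms(2) and iso = assms(4) and E = assms(5) and \<delta> = assms(6,7)
  have V: "V \<in> carrier_mat N K" using iso by (simp add: isometry_def)
  have Ec: "E i \<in> carrier_mat N N" if "i < m" for i
    using E that by (simp add: unitary_error_set_def unitary_def)
  define T where "T = msum N (K * m) {..<m} (\<lambda>i. kron (E i * V) (bra m i))"
  have T: "approx_isometry \<delta> N (K * m) T"
    using assms(8) by (simp add: approx_nondegenerate_code_def T_def)
  then have Tc: "T \<in> carrier_mat N (K * m)" by (simp add: approx_isometry_def)
  obtain W where W: "isometry (K * m) N W"
    and WT: "\<And>x. sqnorm N (\<lambda>i. mapply T x i - mapply W x i) \<le> \<delta>\<^sup>2 * sqnorm (K * m) x"
    using approx_isometry_ex_isometry[OF T \<delta>(2)] by blast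
  define D where "D = decoder_kraus N K m W"
  define J where "J = {..<m} <+> {..<N}"
  have D: "D b \<in> carrier_mat K N" for b by (simp add: D_def)
  have norm: "kraus_normalized N K J D"
    unfolding D_def J_def by (rule decoder_kraus_normalized[OF W K])
  \<comment> \<open>The decoder is fixed before any channel is considered and depends on the code
    matrix through \<open>W\<close>.\<close>
  define Dec where "Dec X = msum K K J (\<lambda>b. D b * X * mat_adjoint (D b))" for X
  have "quantum_channel N K Dec"
    unfolding Dec_def[abs_def] by (rule quantum_channel_kraus[OF norm])
  moreover have "1 / 2 * diamond_norm K K (\<lambda>\<rho>. Dec (\<N> (Enc V \<rho>)) - \<rho>) \<le> \<delta>"
    if \<N>: "\<N> \<in> Channels N (error_span N m E)" for \<N>
  proof -
    obtain L :: nat and c where kn: "kraus_normalized N N {..<L} (\<lambda>a. msum N N {..<m} (\<lambda>i. c a i \<cdot>\<^sub>m E i))"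
      and N_eq: "\<And>\<rho>. \<rho> \<in> carrier_mat N N \<Longrightarrow>
        \<N> \<rho> = msum N N {..<L} (\<lambda>a. msum N N {..<m} (\<lambda>i. c a i \<cdot>\<^sub>m E i) * \<rho> *
          mat_adjoint (msum N N {..<m} (\<lambda>i. c a i \<cdot>\<^sub>m E i)))"
      and c1: "(\<Sum>a<L. sqnorm m (c a)) = 1"
      using Channels_error_span_kraus[OF N E \<N>] by blast
    define A where "A a = msum N N {..<m} (\<lambda>i. c a i \<cdot>\<^sub>m E i)" for a
    have A: "A a \<in> carrier_mat N N" for a by (simp add: A_def msum_def)
    have AV: "A a * V \<in> carrier_mat N K" for a using A V by (rule mult_carrier_mat)
    define F where "F = (\<lambda>(a, b). D b * (A a * V))"
    \<comment> \<open>With W in place of T, decoder operator b sends W (x \<otimes> c_a) to c_ab x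
      on the left part of the sum type and to 0 on the right part. These scalars define the
      comparison family \<open>G\<close>.\<close>
    define g where "g = (\<lambda>(a, b :: nat + nat). case b of Inl j \<Rightarrow> c a j | Inr _ \<Rightarrow> 0)"
    define G where "G z = g z \<cdot>\<^sub>m (1\<^sub>m K :: complex mat)" for z
    have F: "F z \<in> carrier_mat K K" for z
      by (auto simp: F_def split: prod.split intro: mult_carrier_mat[OF D AV])
    have G: "G z \<in> carrier_mat K K" for z by (simp add: G_def)
    define I where "I = {..<L} \<times> J"
    \<comment> \<open>Total squared weight 1 is what makes \<open>G\<close> represent the identity
      channel.\<close>
    have g1: "(\<Sum>z\<in>I. (cmod (g z))\<^sup>2) = 1"
    proof -
      have "(\<Sum>z\<in>I. (cmod (g z))\<^sup>2) = (\<Sum>a<L. \<Sum>b\<in>J. (cmod (g (a, b)))\<^sup>2)"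
        by (simp add: I_def sum.cartesian_product split_def)
      also have "\<dots> = (\<Sum>a<L. sqnorm m (c a))"
        by (simp add: J_def sum.Plus g_def sqnorm_def o_def)
      finally show ?thesis using c1 by simp
    qed
    \<comment> \<open>The columns of T with second tensor index i hold E_i V, so contracting that
      index with c_a yields the noise operator after the encoding.\<close>
    have Ax: "mapply (A a * V) x r = mapply T (\<lambda>p. x (p div m) * c a (p mod m)) r" if r: "r < N" for a x r
    proof -
      have Ti: "T $$ (r, k * m + i) = (E i * V) $$ (r, k)" if "k < K" "i < m" for k i
      proof -
        have "kron (E j * V) (bra m j) $$ (r, k * m + i) = (if j = i then (E i * V) $$ (r, k) else 0)"
          if "j < m" for j
          using r \<open>k < K\<close> \<open>i < m\<close> carrier_matD[OF Ec[OF that]] V mult_add_less_mult[OF \<open>k < K\<close> \<open>i < m\<close>]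
          by (auto simp: kron_def bra_def simp del: index_mult_mat(1))
        then have "T $$ (r, k * m + i) = (\<Sum>j<m. if j = i then (E i * V) $$ (r, k) else 0)"
          using r mult_add_less_mult[OF that] by (simp add: T_def msum_def cong: sum.cong_simp)
        then show ?thesis using that by simp
      qed
      have "mapply T (\<lambda>p. x (p div m) * c a (p mod m)) r =
          (\<Sum>k<K. \<Sum>i<m. (E i * V) $$ (r, k) * (x k * c a i))"
        unfolding mapply_def carrier_matD(2)[OF Tc] sum_lessThan_mult
        by (intro sum.cong refl) (simp add: Ti)
      also have "\<dots> = (\<Sum>i<m. \<Sum>k<K. (E i * V) $$ (r, k) * (x k * c a i))" by (rule sum.swap)
      also have "\<dots> = (\<Sum>i<m. c a i * mapply (E i * V) x r)"
        using V by (simp add: mapply_def sum_distrib_left mult_ac)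
      also have "\<dots> = (\<Sum>i<m. c a i * (\<Sum>k<N. E i $$ (r, k) * mapply V x k))"
      proof (intro sum.cong refl arg_cong2[where f = "(*)"])
        fix i assume "i \<in> {..<m}"
        then have Ei: "E i \<in> carrier_mat N N" using Ec by simp
        show "mapply (E i * V) x r = (\<Sum>k<N. E i $$ (r, k) * mapply V x k)"
          unfolding mapply_mult[OF Ei V r] mapply_def[of "E i"] carrier_matD(2)[OF Ei] ..
      qed
      also have "\<dots> = (\<Sum>i<m. \<Sum>k<N. c a i * E i $$ (r, k) * mapply V x k)"
        by (simp add: sum_distrib_left mult.assoc)
      also have "\<dots> = (\<Sum>k<N. \<Sum>i<m. c a i * E i $$ (r, k) * mapply V x k)" by (rule sum.swap)
      also have "\<dots> = (\<Sum>k<N. A a $$ (r, k) * mapply V x k)"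
        using r carrier_matD[OF Ec]
        by (intro sum.cong refl) (simp add: A_def msum_def sum_distrib_right cong: sum.cong_simp)
      also have "\<dots> = mapply (A a) (mapply V x) r" 
        unfolding mapply_def[of "A a"] carrier_matD(2)[OF A] ..
      finally show ?thesis using mapply_mult[OF A V r] by simp
    qed
    have \<Phi>: "(Dec (\<N> (Enc V \<rho>)) - \<rho>) $$ (i, j) =
        (\<Sum>z\<in>I. (F z * \<rho> * mat_adjoint (F z)) $$ (i, j) - (G z * \<rho> * mat_adjoint (G z)) $$ (i, j))"
      if \<rho>: "\<rho> \<in> carrier_mat K K" and ij: "i < K" "j < K" for \<rho> i j
    proof -
      have S: "Enc V \<rho> \<in> carrier_mat N N"
        unfolding Enc_def using V \<rho> by (meson adjoint_carrier mult_carrier_mat)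
      have ASA: "A a * Enc V \<rho> * mat_adjoint (A a) = A a * V * \<rho> * mat_adjoint (A a * V)" for a
        unfolding Enc_def by (rule sandwich_mult[OF A V \<rho>])
      have ASAc: "A a * Enc V \<rho> * mat_adjoint (A a) \<in> carrier_mat N N" for a
        using A S by (simp add: square_mat_mult)
      have "Dec (\<N> (Enc V \<rho>)) $$ (i, j) =
          (\<Sum>b\<in>J. (D b * msum N N {..<L} (\<lambda>a. A a * Enc V \<rho> * mat_adjoint (A a)) * mat_adjoint (D b)) $$ (i, j))"
        using ij unfolding N_eq[OF S] A_def[symmetric] Dec_def by (simp add: msum_def[of K])
      also have "\<dots> = (\<Sum>b\<in>J. \<Sum>a<L. (F (a, b) * \<rho> * mat_adjoint (F (a, b))) $$ (i, j))"
        unfolding sandwich_msum_index[OF D ASAc ij]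
        by (simp only: ASA F_def split sandwich_mult[OF D AV \<rho>])
      also have "\<dots> = (\<Sum>a<L. \<Sum>b\<in>J. (F (a, b) * \<rho> * mat_adjoint (F (a, b))) $$ (i, j))"
        by (rule sum.swap)
      also have "\<dots> = (\<Sum>z\<in>I. (F z * \<rho> * mat_adjoint (F z)) $$ (i, j))"
        by (simp add: I_def sum.cartesian_product split_def)
      finally have Dec_eq: "Dec (\<N> (Enc V \<rho>)) $$ (i, j) = (\<Sum>z\<in>I. (F z * \<rho> * mat_adjoint (F z)) $$ (i, j))" .
      have "(G z * \<rho> * mat_adjoint (G z)) $$ (i, j) = complex_of_real ((cmod (g z))\<^sup>2) * \<rho> $$ (i, j)" for z
      proof -
        have "(G z * \<rho> * mat_adjoint (G z)) $$ (i, j) =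
            (\<Sum>k<K. \<Sum>l<K. if l = j then (if k = i then g z * \<rho> $$ (i, j) * cnj (g z) else 0) else 0)"
          unfolding sandwich_index[OF G \<rho> ij] using ij by (intro sum.cong refl) (auto simp: G_def)
        also have "\<dots> = (\<Sum>k<K. if k = i then g z * \<rho> $$ (i, j) * cnj (g z) else 0)"
          using ij by (intro sum.cong refl) simp
        also have "\<dots> = g z * \<rho> $$ (i, j) * cnj (g z)" using ij by simp
        finally show ?thesis by (simp add: complex_norm_square mult_ac del: of_real_power)
      qed
      then have "(\<Sum>z\<in>I. (G z * \<rho> * mat_adjoint (G z)) $$ (i, j)) =
          complex_of_real (\<Sum>z\<in>I. (cmod (g z))\<^sup>2) * \<rho> $$ (i, j)"
        by (simp add: sum_distrib_right)
      then show ?thesis using \<rho> ij Dec_eq by (simp add: g1 sum_subtractf)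
    qed
    have Fx: "mapply (F (a, b)) x i = mapply (D b) (mapply (A a * V) x) i" if "i < K" for a b x i
      using mapply_mult[OF D AV that] by (simp add: F_def)
    have Gx: "mapply (G z) x i = g z * x i" if "i < K" for z x i
    proof -
      have "mapply (G z) x i = (\<Sum>k<K. if k = i then g z * x i else 0)"
        unfolding mapply_def using that by (intro sum.cong) (auto simp: G_def)
      then show ?thesis using that by simp
    qed
    \<comment> \<open>Encoding, noise and decoding each preserve the total squared norm, so the
      bound holds with equality and is free of \<delta>.\<close>
    have nF: "(\<Sum>z\<in>I. sqnorm K (mapply (F z) x)) \<le> sqnorm K x" for x
    proof -
      have "(\<Sum>z\<in>I. sqnorm K (mapply (F z) x)) = (\<Sum>a<L. \<Sum>b\<in>J. sqnorm K (mapply (D b) (mapply (A a * V) x)))"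
        unfolding I_def sum.cartesian_product
        by (intro sum.cong refl) (auto simp: Fx intro!: sqnorm_cong)
      also have "\<dots> = (\<Sum>a<L. sqnorm N (mapply (A a) (mapply V x)))"
        using mapply_mult[OF A V] by (simp add: kraus_normalized_sqnorm[OF norm] cong: sqnorm_cong)
      also have "\<dots> = sqnorm K x"
        using kraus_normalized_sqnorm[OF kn, of "mapply V x"] isometry_sqnorm[OF iso] by (simp add: A_def)
      finally show ?thesis by simp
    qed
    have nG: "(\<Sum>z\<in>I. sqnorm K (mapply (G z) x)) \<le> sqnorm K x" for x
    proof -
      have "(\<Sum>z\<in>I. sqnorm K (mapply (G z) x)) = (\<Sum>z\<in>I. (cmod (g z))\<^sup>2 * sqnorm K x)"
        by (simp add: Gx sqnorm_scale cong: sqnorm_cong)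
      then show ?thesis using g1 by (simp add: sum_distrib_right[symmetric])
    qed
    have nD: "(\<Sum>z\<in>I. sqnorm K (\<lambda>i. mapply (F z) x i - mapply (G z) x i)) \<le> \<delta>\<^sup>2 * sqnorm K x" for x
    proof -
      define y where "y a p = x (p div m) * c a (p mod m)" for a p
      have Wy: "mapply (D b) (mapply W (y a)) i = g (a, b) * x i" if "b \<in> J" "i < K" for a b i
        using that mapply_decoder_kraus[OF W, of b i "y a"]
        by (auto simp: D_def J_def g_def y_def split: sum.split)
      \<comment> \<open>On x \<otimes> c_a, F comes from T and G from W by the same decoder
        operator, so the difference is the decoder after T - W; normalization of the decoder then
        removes it from the norm.\<close>
      have "mapply (F (a, b)) x i - mapply (G (a, b)) x i =
          mapply (D b) (\<lambda>r. mapply T (y a) r - mapply W (y a) r) i" if "b \<in> J" "i < K" for a b i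
      proof -
        have "mapply (D b) (mapply (A a * V) x) i = mapply (D b) (mapply T (y a)) i"
          using carrier_matD(2)[OF D] by (intro mapply_cong) (simp add: y_def[abs_def] Ax)
        then show ?thesis using that by (simp add: mapply_diff Fx Gx Wy)
      qed
      then have "(\<Sum>z\<in>I. sqnorm K (\<lambda>i. mapply (F z) x i - mapply (G z) x i)) =
          (\<Sum>z\<in>I. sqnorm K (mapply (D (snd z)) (\<lambda>r. mapply T (y (fst z)) r - mapply W (y (fst z)) r)))"
        by (intro sum.cong refl sqnorm_cong) (auto simp: I_def)
      also have "\<dots> = (\<Sum>a<L. \<Sum>b\<in>J. sqnorm K (mapply (D b) (\<lambda>r. mapply T (y a) r - mapply W (y a) r)))"
        by (simp add: I_def sum.cartesian_product split_def)
      also have "\<dots> = (\<Sum>a<L. sqnorm N (\<lambda>r. mapply T (y a) r - mapply W (y a) r))"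
        by (simp only: kraus_normalized_sqnorm[OF norm])
      also have "\<dots> \<le> (\<Sum>a<L. \<delta>\<^sup>2 * sqnorm (K * m) (y a))" by (intro sum_mono WT)
      \<comment> \<open>Norms multiply on product vectors, so summing over a produces the total
        coefficient weight 1.\<close>
      also have "\<dots> = (\<Sum>a<L. \<delta>\<^sup>2 * (sqnorm K x * sqnorm m (c a)))"
        by (simp add: sqnorm_def sum_lessThan_mult y_def norm_mult power_mult_distrib sum_product)
      also have "\<dots> = \<delta>\<^sup>2 * sqnorm K x * (\<Sum>a<L. sqnorm m (c a))"
        by (simp add: sum_distrib_left mult.assoc)
      finally show ?thesis by (simp add: c1)
    qed
    \<comment> \<open>The factor 1 / 2 in the disturbance cancels the 2 of the diamond norm
      bound.\<close>
    from diamond_norm_kraus_difference_le[OF F G \<Phi> nF nG nD \<delta>(1)] show ?thesis by simp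
  qed
  ultimately show ?thesis unfolding corrects_with_disturbance_def by blast
qed

end
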